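(* The computational complexity of the global search over a single coordinate (Algorithm 4, described in the context), which for a given $r\in\mathcal N$ and given fixed arrival times $a_j\in[\underline a,\overline a]$, $j\ne r$, minimizes the total cost over the arrival time $x\in[\underline a,\overline a]$ of user $r$, is at most $O(N^5)$.
   Context: $N\ge1$ is an integer, $\mathcal N=\{1,\dots,N\}$, and $\alpha,\beta>0$ satisfy $N<\beta/\alpha+1$. For an arrival vector $\mathbf a\in\mathbb R^N$ (not necessarily ordered), the departure vector $\mathbf d(\mathbf a)$ is the unique $\mathbf d$ with $a_i\le d_i$ satisfying $$1=\int_{a_i}^{d_i}\Big[\beta-\alpha\Big(\sum_{j=1}^N \mathbf 1\{t\in[a_j,d_j]\}-1\Big)\Big]dt,\qquad i\in\mathcal N.$$ Given $d_1^*\le\dots\le d_N^*$ and $\gamma\ge0$, the total cost is $c(\mathbf a)=\sum_{i=1}^N[(d_i(\mathbf a)-d_i^* )^2+\gamma(d_i(\mathbf a)-a_i)]$, and $\underline a=d_1^*-\frac{N}{\beta-\alpha(N-1)}$, $\overline a=d_N^*+\frac{N}{\beta-\alpha(N-1)}$. Complexity is measured in arithmetic operations and comparisons on real numbers. If arrivals are indexed in increasing order, then with $k_i=\max\{k:a_k\le d_i\}$ and $h_i=\min\{h:d_h\ge a_i\}$ the departures satisfy $$(\ast)\qquad(\beta-\alpha(k_i-i))d_i=1+(\beta-\alpha(i-h_i))a_i+\alpha\Big(\sum_{j=h_i}^{i-1}d_j-\sum_{j=i+1}^{k_i}a_j\Big),\quad i\in\mathcal N .$$ As $x$ (the arrival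 time of user $r$) increases from $\underline a$ to $\overline a$ with the other arrival times fixed, a breakpoint is a value of $x$ at which the relative order of the $2N$ arrival and departure times changes; between consecutive breakpoints the order (hence $\mathbf k,\mathbf h$) is constant, each departure time is affine in $x$, $d_i=\theta_ix+\eta_i$, and the total cost is a convex quadratic function of $x$. Algorithm 4 starts at $x=\underline a$, where the departures and $\mathbf k,\mathbf h$ are computed, and traverses the successive intervals between breakpoints up to $\overline a$. On each interval it computes the coefficients $(\theta_i,\eta_i)$ for $i=1,\dots,N$ recursively from $(\ast)$, determines the next breakpoint from these affine functions, minimizes the quadratic cost on the interval and updates the best value found so far, and then updates the order of arrivals and $\mathbf k,\mathbf h$ and moves to the next interval. It returns the best $x$ and cost found. *)

theory Defs
  imports
    "HOL-Analysis.Analysis"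
    "HOL-Library.State_Monad"
    "HOL-Library.While_Combinator"
    "HOL-Library.Landau_Symbols"
begin

section \<open>The processor sharing model with linear slowdown\<close>

text \<open>
  Vectors of \<open>\<real>\<^sup>N\<close> are functions on \<open>nat\<close> of which only the arguments \<open>1, \<dots>, N\<close> matter;
  departure vectors are made unique as functions by \<^const>\<open>extensional\<close>.
\<close>

context
  fixes N :: nat and \<alpha> \<beta> :: real
begin

definition is_departure_vector :: "(nat \<Rightarrow> real) \<Rightarrow> (nat \<Rightarrow> real) \<Rightarrow> bool" where
  "is_departure_vector a d \<longleftrightarrow>
    (\<forall>i\<in>{1..N}. a i \<le> d i \<and>
      1 = integral {a i..d i}
            (\<lambda>t. \<beta> - \<alpha> * ((\<Sum>j=1..N. indicat_real {a j..d j} t) - 1)))"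

definition departures :: "(nat \<Rightarrow> real) \<Rightarrow> nat \<Rightarrow> real" where
  "departures a = (THE d. d \<in> extensional {1..N} \<and> is_departure_vector a d)"

definition total_cost :: "real \<Rightarrow> (nat \<Rightarrow> real) \<Rightarrow> (nat \<Rightarrow> real) \<Rightarrow> real" where
  "total_cost \<gamma> d_opt a =
    (\<Sum>i=1..N. (departures a i - d_opt i)\<^sup>2 + \<gamma> * (departures a i - a i))"

definition lower_arrival :: "(nat \<Rightarrow> real) \<Rightarrow> real" where
  "lower_arrival d_opt = d_opt 1 - real N / (\<beta> - \<alpha> * (real N - 1))"

definition upper_arrival :: "(nat \<Rightarrow> real) \<Rightarrow> real" where
  "upper_arrival d_opt = d_opt N + real N / (\<beta> - \<alpha> * (real N - 1))"

end


section \<open>Counting operations on real numbers\<close>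

text \<open>
  A program is a state transformer on a counter that is increased by every arithmetic operation
  and by every comparison on real numbers. Only the operations with subscript \<open>c\<close> work on reals.
  Bookkeeping on integer indices (users, positions, case distinctions on them, array access, and
  reading such an integer as a real constant) is not an operation on real numbers and is free.
\<close>

type_synonym 'a counted = "(nat, 'a) state"

abbreviation val :: "'a \<Rightarrow> 'a counted" where
  "val \<equiv> State_Monad.return"

definition counted2 :: "(real \<Rightarrow> real \<Rightarrow> 'a) \<Rightarrow> real counted \<Rightarrow> real counted \<Rightarrow> 'a counted" where
  "counted2 f m n =
    do { x \<leftarrow> m; y \<leftarrow> n; State_Monad.update Suc; val (f x y) }"

abbreviation add_c (infixl "+\<^sub>c" 65) where "m +\<^sub>c n \<equiv> counted2 (+) m n"
abbreviation sub_c (infixl "-\<^sub>c" 65) where "m -\<^sub>c n \<equiv> counted2 (-) m n"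
abbreviation mul_c (infixl "*\<^sub>c" 70) where "m *\<^sub>c n \<equiv> counted2 (*) m n"
abbreviation div_c (infixl "'/\<^sub>c" 70) where "m /\<^sub>c n \<equiv> counted2 (/) m n"
abbreviation less_c (infix "<\<^sub>c" 50) where "m <\<^sub>c n \<equiv> counted2 (<) m n"
abbreviation le_c (infix "\<le>\<^sub>c" 50) where "m \<le>\<^sub>c n \<equiv> counted2 (\<le>) m n"

primrec sum_c :: "real counted list \<Rightarrow> real counted" where
  "sum_c [] = val 0"
| "sum_c (m # ms) = m +\<^sub>c sum_c ms"

text \<open>A counted while loop; the result is \<^const>\<open>None\<close> iff the loop does not terminate.\<close>

definition while_c :: "('s \<Rightarrow> bool) \<Rightarrow> ('s \<Rightarrow> 's counted) \<Rightarrow> 's \<times> nat \<Rightarrow> ('s \<times> nat) option" where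
  "while_c b c = while_option (\<lambda>(s, n). b s) (\<lambda>(s, n). run_state (c s) n)"


section \<open>Global search over a single coordinate\<close>

text \<open>
  The algorithm works with positions \<open>1, \<dots>, N\<close> in the order of arrival instead of users:
  \<open>user_at i\<close> is the user at position \<open>i\<close>, and \<open>pos\<close> is the position of user \<open>r\<close>. Because the order of
  departures is the order of arrivals, the relative order of all \<open>2N\<close> arrival and departure
  times is given by \<open>user_at\<close> together with the indices \<open>k i\<close>.
  While times coincide, these may record any order compatible with the times.
\<close>

record search_state =
  left_end :: real
  user_at :: "nat \<Rightarrow> nat"
  pos :: nat
  kvec :: "nat \<Rightarrow> nat"
  best_x :: real
  best_cost :: real
  finished :: bool

text \<open>
  The index \<open>h\<^sub>i = min {h. d\<^sub>h \<ge> a\<^sub>i}\<close> is read off from \<open>k\<close>: for \<open>h < i\<close>, \<open>d\<^sub>h \<ge> a\<^sub>i\<close> means \<open>k\<^sub>h \<ge> i\<close>,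
  and \<open>d\<^sub>i \<ge> a\<^sub>i\<close> always holds.
\<close>

definition hvec :: "(nat \<Rightarrow> nat) \<Rightarrow> nat \<Rightarrow> nat" where
  "hvec k i = hd (filter (\<lambda>h. h = i \<or> i \<le> k h) [1..<Suc i])"

primrec insert_user :: "(nat \<Rightarrow> real) \<Rightarrow> nat \<Rightarrow> nat list \<Rightarrow> nat list counted" where
  "insert_user a u [] = val [u]"
| "insert_user a u (v # vs) =
    do { b \<leftarrow> val (a u) \<le>\<^sub>c val (a v);
         if b then val (u # v # vs)
         else do { ws \<leftarrow> insert_user a u vs; val (v # ws) } }"

primrec sort_users :: "(nat \<Rightarrow> real) \<Rightarrow> nat list \<Rightarrow> nat list counted" where
  "sort_users a [] = val []"
| "sort_users a (u # us) = do { vs \<leftarrow> sort_users a us; insert_user a u vs }"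

datatype event =
    Stop
  | Arrival_Swap    \<comment> \<open>the arrival of user \<open>r\<close> meets the next arrival\<close>
  | Departure_Up nat    \<comment> \<open>departure \<open>i\<close> passes from before to after arrival \<open>k i + 1\<close>\<close>
  | Departure_Down nat    \<comment> \<open>departure \<open>i\<close> passes from after to before arrival \<open>k i\<close>\<close>

context
  fixes N :: nat and \<alpha> \<beta> \<gamma> :: real and d_opt :: "nat \<Rightarrow> real"
begin

subsection \<open>Initialization\<close>

text \<open>
  For arrivals \<open>b\<close> in increasing order, departure \<open>i\<close> is determined after departures \<open>1, \<dots>, i - 1\<close>.
  With \<open>k\<close> as a candidate for \<open>k\<^sub>i\<close>, the equation \<open>(\<beta> - \<alpha>(k\<^sub>i - i)) d\<^sub>i = \<dots>\<close> reads \<open>c * d = s\<close>;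
  the candidate is increased as long as the solution \<open>s / c\<close> is not before the next arrival.
\<close>

primrec solve_departure ::
  "(nat \<Rightarrow> real) \<Rightarrow> nat \<Rightarrow> nat list \<Rightarrow> real \<Rightarrow> real \<Rightarrow> (real \<times> nat) counted" where
  "solve_departure b k [] s c = do { d \<leftarrow> val s /\<^sub>c val c; val (d, k) }"
| "solve_departure b k (j # js) s c =
    do { d \<leftarrow> val s /\<^sub>c val c;
         before \<leftarrow> val d <\<^sub>c val (b j);
         if before then val (d, k)
         else do { s' \<leftarrow> val s -\<^sub>c val \<alpha> *\<^sub>c val (b j);
                   c' \<leftarrow> val c -\<^sub>c val \<alpha>;
                   solve_departure b j js s' c' } }"

primrec initial_departures ::
  "(nat \<Rightarrow> real) \<Rightarrow> nat \<Rightarrow> ((nat \<Rightarrow> real) \<times> (nat \<Rightarrow> nat)) counted" where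
  "initial_departures b 0 = val (\<lambda>_. 0, \<lambda>_. 0)"
| "initial_departures b (Suc n) =
    do { (d, k) \<leftarrow> initial_departures b n;
         let i = Suc n; let h = hvec k i;
         s \<leftarrow> val 1 +\<^sub>c (val \<beta> -\<^sub>c val \<alpha> *\<^sub>c val (real (i - h))) *\<^sub>c val (b i)
              +\<^sub>c val \<alpha> *\<^sub>c sum_c (map (\<lambda>j. val (d j)) [h..<i]);
         (di, ki) \<leftarrow> solve_departure b i [Suc i..<Suc N] s \<beta>;
         val (d(i := di), k(i := ki)) }"

definition initial_state ::
  "nat \<Rightarrow> (nat \<Rightarrow> real) \<Rightarrow> real \<Rightarrow> search_state counted" where
  "initial_state r a lb =
    do { let a0 = a(r := lb);
         us \<leftarrow> sort_users a0 [1..<Suc N];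
         let \<sigma> = (\<lambda>i. us ! (i - 1));
         let b = (\<lambda>i. a0 (\<sigma> i));
         (d, k) \<leftarrow> initial_departures b N;
         c \<leftarrow> sum_c (map (\<lambda>i.
                (val (d i) -\<^sub>c val (d_opt (\<sigma> i))) *\<^sub>c (val (d i) -\<^sub>c val (d_opt (\<sigma> i)))
                +\<^sub>c val \<gamma> *\<^sub>c (val (d i) -\<^sub>c val (b i))) [1..<Suc N]);
         val \<lparr> left_end = lb, user_at = \<sigma>, pos = hd (filter (\<lambda>i. \<sigma> i = r) [1..<Suc N]),
               kvec = k, best_x = lb, best_cost = c, finished = False \<rparr> }"

subsection \<open>One interval\<close>

text \<open>
  On the current interval the arrival at position \<open>i\<close> is \<open>\<phi> i * x + \<zeta> i\<close>, where \<open>x\<close> is the arrival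
  time of user \<open>r\<close>, and departure \<open>i\<close> is \<open>\<theta> i * x + \<eta> i\<close>.
\<close>

primrec coefficients ::
  "(nat \<Rightarrow> nat) \<Rightarrow> (nat \<Rightarrow> real) \<Rightarrow> (nat \<Rightarrow> real) \<Rightarrow> nat
    \<Rightarrow> ((nat \<Rightarrow> real) \<times> (nat \<Rightarrow> real)) counted" where
  "coefficients k \<phi> \<zeta> 0 = val (\<lambda>_. 0, \<lambda>_. 0)"
| "coefficients k \<phi> \<zeta> (Suc n) =
    do { (\<theta>, \<eta>) \<leftarrow> coefficients k \<phi> \<zeta> n;
         let i = Suc n; let h = hvec k i;
         t \<leftarrow> ((val \<beta> -\<^sub>c val \<alpha> *\<^sub>c val (real (i - h))) *\<^sub>c val (\<phi> i)
              +\<^sub>c val \<alpha> *\<^sub>c (sum_c (map (\<lambda>j. val (\<theta> j)) [h..<i])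
                           -\<^sub>c sum_c (map (\<lambda>j. val (\<phi> j)) [Suc i..<Suc (k i)])))
              /\<^sub>c (val \<beta> -\<^sub>c val \<alpha> *\<^sub>c val (real (k i - i)));
         e \<leftarrow> (val 1 +\<^sub>c (val \<beta> -\<^sub>c val \<alpha> *\<^sub>c val (real (i - h))) *\<^sub>c val (\<zeta> i)
              +\<^sub>c val \<alpha> *\<^sub>c (sum_c (map (\<lambda>j. val (\<eta> j)) [h..<i])
                           -\<^sub>c sum_c (map (\<lambda>j. val (\<zeta> j)) [Suc i..<Suc (k i)])))
              /\<^sub>c (val \<beta> -\<^sub>c val \<alpha> *\<^sub>c val (real (k i - i)));
         val (\<theta>(i := t), \<eta>(i := e)) }"

text \<open>
  The possible events of departure \<open>i\<close>, with the value of \<open>x\<close> at which they happen: it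
  meets the next arrival and moves up relative to it, or it meets the last arrival before it
  and moves down relative to it.
\<close>

definition departure_events ::
  "(nat \<Rightarrow> nat) \<Rightarrow> (nat \<Rightarrow> real) \<Rightarrow> (nat \<Rightarrow> real) \<Rightarrow> (nat \<Rightarrow> real) \<Rightarrow> (nat \<Rightarrow> real) \<Rightarrow> nat
    \<Rightarrow> (real \<times> event) list counted" where
  "departure_events k \<phi> \<zeta> \<theta> \<eta> i =
    do { up \<leftarrow> (if k i < N then
                do { let j = Suc (k i);
                     rising \<leftarrow> val (\<phi> j) <\<^sub>c val (\<theta> i);
                     if rising then
                       do { t \<leftarrow> (val (\<zeta> j) -\<^sub>c val (\<eta> i)) /\<^sub>c (val (\<theta> i) -\<^sub>c val (\<phi> j));
                            val [(t, Departure_Up i)] }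
                     else val [] }
              else val []);
         down \<leftarrow> (if i < k i then
                do { let j = k i;
                     falling \<leftarrow> val (\<theta> i) <\<^sub>c val (\<phi> j);
                     if falling then
                       do { t \<leftarrow> (val (\<zeta> j) -\<^sub>c val (\<eta> i)) /\<^sub>c (val (\<theta> i) -\<^sub>c val (\<phi> j));
                            val [(t, Departure_Down i)] }
                     else val [] }
              else val []);
         val (up @ down) }"

primrec earliest :: "real \<times> event \<Rightarrow> (real \<times> event) list \<Rightarrow> (real \<times> event) counted" where
  "earliest e [] = val e"
| "earliest e (f # fs) =
    do { b \<leftarrow> val (fst f) <\<^sub>c val (fst e); earliest (if b then f else e) fs }"

primrec all_departure_events ::
  "(nat \<Rightarrow> nat) \<Rightarrow> (nat \<Rightarrow> real) \<Rightarrow> (nat \<Rightarrow> real) \<Rightarrow> (nat \<Rightarrow> real) \<Rightarrow> (nat \<Rightarrow> real)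
    \<Rightarrow> nat list \<Rightarrow> (real \<times> event) list counted" where
  "all_departure_events k \<phi> \<zeta> \<theta> \<eta> [] = val []"
| "all_departure_events k \<phi> \<zeta> \<theta> \<eta> (i # is) =
    do { es \<leftarrow> departure_events k \<phi> \<zeta> \<theta> \<eta> i;
         fs \<leftarrow> all_departure_events k \<phi> \<zeta> \<theta> \<eta> is;
         val (es @ fs) }"

text \<open>
  The next breakpoint, or \<open>ub\<close> with \<^const>\<open>Stop\<close> if there is none below \<open>ub\<close>. If several changes of
  the order happen at the same \<open>x\<close>, they are treated one after the other, separated by
  intervals of length zero: a change of the order of arrivals first, then the departure with the
  smallest position. This choice matters: the coefficients of departure \<open>i\<close> depend
  on the departures before it, so its changes are correct only once theirs are done.
\<close>

definition next_breakpoint ::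
  "real \<Rightarrow> nat \<Rightarrow> (nat \<Rightarrow> nat) \<Rightarrow> (nat \<Rightarrow> real) \<Rightarrow> (nat \<Rightarrow> real) \<Rightarrow> (nat \<Rightarrow> real) \<Rightarrow> (nat \<Rightarrow> real)
    \<Rightarrow> (real \<times> event) counted" where
  "next_breakpoint ub p k \<phi> \<zeta> \<theta> \<eta> =
    do { es \<leftarrow> all_departure_events k \<phi> \<zeta> \<theta> \<eta> [1..<Suc N];
         earliest (ub, Stop) ((if p < N then [(\<zeta> (Suc p), Arrival_Swap)] else []) @ es) }"

text \<open>The coefficients \<open>A x\<^sup>2 + B x + C\<close> of the total cost.\<close>

definition cost_coefficients ::
  "(nat \<Rightarrow> nat) \<Rightarrow> (nat \<Rightarrow> real) \<Rightarrow> (nat \<Rightarrow> real) \<Rightarrow> (nat \<Rightarrow> real) \<Rightarrow> (nat \<Rightarrow> real)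
    \<Rightarrow> (real \<times> real \<times> real) counted" where
  "cost_coefficients \<sigma> \<phi> \<zeta> \<theta> \<eta> =
    do { A \<leftarrow> sum_c (map (\<lambda>i. val (\<theta> i) *\<^sub>c val (\<theta> i)) [1..<Suc N]);
         B \<leftarrow> sum_c (map (\<lambda>i.
                val 2 *\<^sub>c val (\<theta> i) *\<^sub>c (val (\<eta> i) -\<^sub>c val (d_opt (\<sigma> i)))
                +\<^sub>c val \<gamma> *\<^sub>c (val (\<theta> i) -\<^sub>c val (\<phi> i))) [1..<Suc N]);
         C \<leftarrow> sum_c (map (\<lambda>i.
                (val (\<eta> i) -\<^sub>c val (d_opt (\<sigma> i))) *\<^sub>c (val (\<eta> i) -\<^sub>c val (d_opt (\<sigma> i)))
                +\<^sub>c val \<gamma> *\<^sub>c (val (\<eta> i) -\<^sub>c val (\<zeta> i))) [1..<Suc N]);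
         val (A, B, C) }"

definition minimize_quadratic ::
  "real \<Rightarrow> real \<Rightarrow> real \<Rightarrow> real \<Rightarrow> real \<Rightarrow> (real \<times> real) counted" where
  "minimize_quadratic A B C l u =
    do { strict \<leftarrow> val 0 <\<^sub>c val A;
         x \<leftarrow> (if strict then
                do { v \<leftarrow> (val 0 -\<^sub>c val B) /\<^sub>c (val 2 *\<^sub>c val A);
                     below \<leftarrow> val v <\<^sub>c val l;
                     above \<leftarrow> val u <\<^sub>c val v;
                     val (if below then l else if above then u else v) }
              else
                do { increasing \<leftarrow> val 0 \<le>\<^sub>c val B;
                     val (if increasing then l else u) });
         c \<leftarrow> (val A *\<^sub>c val x +\<^sub>c val B) *\<^sub>c val x +\<^sub>c val C;
         val (x, c) }"

fun apply_event :: "event \<Rightarrow> search_state \<Rightarrow> search_state" where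
  "apply_event Stop s = s\<lparr>finished := True\<rparr>"
| "apply_event Arrival_Swap s =
    s\<lparr>user_at := (user_at s)(pos s := user_at s (Suc (pos s)), Suc (pos s) := user_at s (pos s)),
      pos := Suc (pos s)\<rparr>"
| "apply_event (Departure_Up i) s = s\<lparr>kvec := (kvec s)(i := kvec s i + 1)\<rparr>"
| "apply_event (Departure_Down i) s = s\<lparr>kvec := (kvec s)(i := kvec s i - 1)\<rparr>"

definition search_step ::
  "(nat \<Rightarrow> real) \<Rightarrow> real \<Rightarrow> search_state \<Rightarrow> search_state counted" where
  "search_step a ub s =
    do { let \<phi> = (\<lambda>i. if i = pos s then 1 else 0);
         let \<zeta> = (\<lambda>i. if i = pos s then 0 else a (user_at s i));
         (\<theta>, \<eta>) \<leftarrow> coefficients (kvec s) \<phi> \<zeta> N;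
         (x', e) \<leftarrow> next_breakpoint ub (pos s) (kvec s) \<phi> \<zeta> \<theta> \<eta>;
         (A, B, C) \<leftarrow> cost_coefficients (user_at s) \<phi> \<zeta> \<theta> \<eta>;
         (x, c) \<leftarrow> minimize_quadratic A B C (left_end s) x';
         better \<leftarrow> val c <\<^sub>c val (best_cost s);
         let s' = (if better then s\<lparr>best_x := x, best_cost := c\<rparr> else s);
         val (apply_event e (s'\<lparr>left_end := x'\<rparr>)) }"

subsection \<open>The algorithm\<close>

text \<open>
  \<open>global_search r a = Some (x, c, n)\<close> means that the search over the arrival time of user \<open>r\<close>
  terminates with the best arrival time \<open>x\<close> and cost \<open>c\<close> after \<open>n\<close> operations on real numbers. The
  value \<open>a r\<close> is not used.
\<close>

definition global_search :: "nat \<Rightarrow> (nat \<Rightarrow> real) \<Rightarrow> (real \<times> real \<times> nat) option" where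
  "global_search r a =
    (let ((s0, ub), n0) = run_state
       (do { w \<leftarrow> val (real N) /\<^sub>c (val \<beta> -\<^sub>c val \<alpha> *\<^sub>c (val (real N) -\<^sub>c val 1));
             lb \<leftarrow> val (d_opt 1) -\<^sub>c val w;
             ub \<leftarrow> val (d_opt N) +\<^sub>c val w;
             s \<leftarrow> initial_state r a lb;
             val (s, ub) }) 0
     in map_option (\<lambda>(s, n). (best_x s, best_cost s, n))
          (while_c (\<lambda>s. \<not> finished s) (search_step a ub) (s0, n0)))"

end

end

theory Submission
  imports Defs
begin

text \<open>
  For arrivals \<open>b\<close> in increasing order, departure \<open>i\<close> solves an equation whose left-hand side is increasing in
  \<open>d\<^sub>i\<close> and jointly concave in \<open>d\<^sub>i\<close> and the arrival times, and whose right-hand side is an increasing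
  convex function of \<open>d\<^sub>1, \<dots>, d\<^sub>i\<^sub>-\<^sub>1\<close> and \<open>b\<^sub>i\<close>. Hence, as long as the order of arrivals does not change, all
  departures are convex in the arrival time \<open>x\<close> of user \<open>r\<close>, although they need not be monotone in it.
  So between two changes of the order of arrivals each departure crosses each arrival at most
  twice, first downwards and then upwards. As \<open>x\<close> overtakes fewer than \<open>N\<close> arrivals, there are \<open>O(N\<^sup>3)\<close>
  breakpoints, each of which costs \<open>O(N\<^sup>2)\<close> operations.

  Breakpoints at which several times coincide are the delicate case. There, the recorded order
  always is one of the orders compatible with the times, so that the departure times computed from
  it are correct at the breakpoint itself; and when departure \<open>i\<close> has an event, the departures
  before it have already settled, which determines where the true departure \<open>i\<close> goes to the right
  of the breakpoint.
\<close>

section \<open>Departure times\<close>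

text \<open>Counting changes of the true order does not suffice: several recorded changes may share
  one breakpoint, and intervals of length zero bring no progress in x. Progress is measured by an
  integer potential instead. Each pair of a departure and an arrival gets a bound on the events it
  may still have, read off from the recorded order and from whether the true departure lies above
  the arrival on the rest of the current arrival order, left end excluded. Convexity forces every
  departure event to lower the potential strictly. A swap of arrivals may raise it again, but never
  beyond 2 N^2, and there are at most N - 1 swaps. The same potential proves termination and pays
  for the operations. The condition \<alpha> (N - 1) < \<beta> bounds from below the slope of each
  balance equation in its own departure, which makes it uniquely solvable and all denominators
  positive. Optimality and running time are proved together: the computed lines have to be the true
  departures up to the breakpoint before an event can be charged to a true crossing. Working with
  positions instead of users keeps a swap harmless, since at a tie all times indexed by position
  stay the same.\<close>

definition overlap :: "real \<Rightarrow> real \<Rightarrow> real \<Rightarrow> real \<Rightarrow> real" where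
  "overlap s t u v = max 0 (min t v - max s u)"

lemma has_integral_indicator_overlap:
  "((\<lambda>x. indicat_real {u..v} x) has_integral overlap s t u v) {s..t}"
proof -
  have "((\<lambda>x. 1::real) has_integral overlap s t u v) ({s..t} \<inter> {u..v})"
    using has_integral_const_real[of "1::real" "max s u" "min t v"]
    by (simp add: overlap_def Int_atLeastAtMost max_def split: if_splits)
  then show ?thesis
    by (subst (asm) Int_commute, subst (asm) has_integral_restrict_Int[symmetric])
       (auto simp: indicator_def of_bool_def cong: if_cong)
qed

lemma mono_on_intervalD:
  fixes b :: "nat \<Rightarrow> real"
  shows "mono_on {1..n} b \<Longrightarrow> 1 \<le> i \<Longrightarrow> i \<le> j \<Longrightarrow> j \<le> n \<Longrightarrow> b i \<le> b j"
  by (rule mono_onD) auto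

section \<open>Balance equations in sorted order: existence, uniqueness and monotonicity of the
  solution\<close>

locale slowdown_system =
  fixes N :: nat and \<alpha> \<beta> :: real
  assumes alpha_pos: "0 < \<alpha>" and N_pos: "1 \<le> N" and rate_pos: "\<alpha> * (real N - 1) < \<beta>"
begin

text \<open>
  If arrivals \<open>b\<close> and departures \<open>d\<close> are both increasing, then user \<open>i\<close> is in the system together with
  \<open>j < i\<close> for the time \<open>max 0 (d j - b i)\<close> and with \<open>j > i\<close> for the time \<open>max 0 (d i - b j)\<close>; so the
  integral equation for departure \<open>i\<close> becomes \<open>gap b i (d i) = load b d i\<close>.
\<close>

definition gap :: "(nat \<Rightarrow> real) \<Rightarrow> nat \<Rightarrow> real \<Rightarrow> real" where
  "gap b i t = \<beta> * (t - b i) - \<alpha> * (\<Sum>j\<in>{i<..N}. max 0 (t - b j))"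

definition load :: "(nat \<Rightarrow> real) \<Rightarrow> (nat \<Rightarrow> real) \<Rightarrow> nat \<Rightarrow> real" where
  "load b d i = 1 + \<alpha> * (\<Sum>j\<in>{1..<i}. max 0 (d j - b i))"

definition balanced :: "(nat \<Rightarrow> real) \<Rightarrow> (nat \<Rightarrow> real) \<Rightarrow> nat \<Rightarrow> bool" where
  "balanced b d i \<longleftrightarrow> b i \<le> d i \<and> gap b i (d i) = load b d i"

lemma rate_pos': "real m \<le> real N - 1 \<Longrightarrow> 0 < \<beta> - \<alpha> * real m"
  using rate_pos alpha_pos by (smt (verit) mult_left_mono)

lemma load_ge_1: "1 \<le> load b d i"
  unfolding load_def using alpha_pos by (simp add: sum_nonneg)

text \<open>Each of the at most N - 1 subtracted terms has slope at most 1, so \<open>gap\<close>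
  grows at least with the positive slope \<beta> - \<alpha> (N - 1). Injectivity and solvability
  both come from this.\<close>

lemma gap_diff:
  assumes "1 \<le> i" "s \<le> t"
  shows "(\<beta> - \<alpha> * (real N - 1)) * (t - s) \<le> gap b i t - gap b i s"
proof -
  have "(\<Sum>j\<in>{i<..N}. max 0 (t - b j)) - (\<Sum>j\<in>{i<..N}. max 0 (s - b j))
      = (\<Sum>j\<in>{i<..N}. max 0 (t - b j) - max 0 (s - b j))"
    by (simp add: sum_subtractf)
  also have "\<dots> \<le> (\<Sum>j\<in>{i<..N}. t - s)"
    using assms by (intro sum_mono) auto
  also have "\<dots> = real (N - i) * (t - s)" by simp
  also have "\<dots> \<le> (real N - 1) * (t - s)"
    using assms N_pos by (intro mult_right_mono) auto
  finally have "\<alpha> * ((\<Sum>j\<in>{i<..N}. max 0 (t - b j)) - (\<Sum>j\<in>{i<..N}. max 0 (s - b j)))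
      \<le> \<alpha> * ((real N - 1) * (t - s))"
    using alpha_pos by (intro mult_left_mono) auto
  then show ?thesis unfolding gap_def by (simp add: algebra_simps)
qed

lemma gap_less_iff: "1 \<le> i \<Longrightarrow> gap b i s < gap b i t \<longleftrightarrow> s < t"
proof -
  assume i: "1 \<le> i"
  have *: "gap b i s < gap b i t" if "s < t" for s t
    using gap_diff[OF i less_imp_le[OF that], of b] rate_pos that
    by (smt (verit) mult_pos_pos)
  then show ?thesis by (metis linorder_neqE_linordered_idom order_less_asym)
qed

lemma gap_inject: "1 \<le> i \<Longrightarrow> gap b i s = gap b i t \<longleftrightarrow> s = t"
  by (metis gap_less_iff less_irrefl linorder_neqE_linordered_idom)

lemma continuous_gap: "continuous_on S (gap b i)"
  unfolding gap_def by (intro continuous_intros)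

lemma gap_self: "mono_on {1..N} b \<Longrightarrow> i \<in> {1..N} \<Longrightarrow> gap b i (b i) = 0"
  unfolding gap_def by (auto intro!: sum.neutral max_absorb1 mono_on_intervalD[of N b])

lemma balanced_exists:
  assumes "mono_on {1..N} b" "n \<le> N"
  shows "\<exists>d. \<forall>i\<in>{1..n}. balanced b d i"
  using assms(2)
proof (induction n)
  case 0
  then show ?case by auto
next
  case (Suc n)
  then obtain d where d: "\<forall>i\<in>{1..n}. balanced b d i" by auto
  define L where "L = load b d (Suc n)"
  \<comment> \<open>By the slope bound, \<open>gap\<close> has climbed from 0 to at least
    \<open>L\<close> at this point, the right end for the intermediate value theorem.\<close>
  define t where "t = b (Suc n) + L / (\<beta> - \<alpha> * (real N - 1))"
  have L: "1 \<le> L" unfolding L_def by (rule load_ge_1)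
  then have t: "b (Suc n) \<le> t" unfolding t_def using rate_pos by simp
  have g0: "gap b (Suc n) (b (Suc n)) = 0" using Suc.prems assms gap_self by auto
  have "L \<le> gap b (Suc n) t"
    using gap_diff[of "Suc n", OF _ t, of b] rate_pos unfolding g0 by (simp add: t_def)
  then obtain x where x: "b (Suc n) \<le> x" "gap b (Suc n) x = L"
    using IVT'[of "gap b (Suc n)" "b (Suc n)" L t] L g0 t continuous_gap by auto
  have l: "load b (d(Suc n := x)) i = load b d i" if "i \<le> Suc n" for i
    using that unfolding load_def by (auto intro!: sum.cong)
  have "\<forall>i\<in>{1..Suc n}. balanced b (d(Suc n := x)) i"
    using d x unfolding balanced_def by (auto simp: l L_def le_Suc_eq)
  then show ?case by blast
qed

lemma balanced_unique:
  assumes "\<forall>i\<in>{1..n}. balanced b d i" "\<forall>i\<in>{1..n}. balanced b e i" "i \<in> {1..n}"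
  shows "d i = e i"
  using assms(3)
proof (induction i rule: less_induct)
  case (less i)
  have "load b d i = load b e i"
    unfolding load_def using less by (auto intro!: sum.cong)
  then have "gap b i (d i) = gap b i (e i)" using assms less.prems unfolding balanced_def by metis
  then show ?case using less.prems by (subst (asm) gap_inject) auto
qed

text \<open>Insert \<open>d i\<close> into the equation of the next position, with \<open>D\<close>
  the distance of the two arrivals. The left side loses \<beta> D, the load loses at most \<alpha>
  (i - 1) D, and both gain \<alpha> times the time that the two users share. As \<alpha> (i - 1)
  \<le> \<beta>, the point \<open>d i\<close> is not beyond the solution.\<close>

lemma balanced_Suc_le:
  assumes b: "mono_on {1..N} b" and i: "1 \<le> i" "Suc i \<le> N"
    and di: "balanced b d i" and ds: "balanced b d (Suc i)"
  shows "d i \<le> d (Suc i)"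
proof (cases "d i \<le> b (Suc i)")
  case True
  then show ?thesis using ds unfolding balanced_def by simp
next
  case False
  define D where "D = b (Suc i) - b i"
  have D: "0 \<le> D" unfolding D_def using mono_on_intervalD[OF b, of i "Suc i"] i by simp
  have split: "{i<..N} = insert (Suc i) {Suc i<..N}" using i by auto
  have g: "gap b (Suc i) (d i) = gap b i (d i) - \<beta> * D + \<alpha> * (d i - b (Suc i))"
    unfolding gap_def split D_def using False by (simp add: algebra_simps)
  have sum: "(\<Sum>j\<in>{1..<i}. max 0 (d j - b i)) - real (i - 1) * D
      \<le> (\<Sum>j\<in>{1..<i}. max 0 (d j - b (Suc i)))"
  proof -
    have "(\<Sum>j\<in>{1..<i}. max 0 (d j - b i) - D) \<le> (\<Sum>j\<in>{1..<i}. max 0 (d j - b (Suc i)))"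
      using D by (intro sum_mono) (auto simp: D_def)
    then show ?thesis by (simp add: sum_subtractf)
  qed
  have "{1..<Suc i} = insert i {1..<i}" using i by auto
  then have l: "load b d (Suc i)
      = 1 + \<alpha> * (d i - b (Suc i)) + \<alpha> * (\<Sum>j\<in>{1..<i}. max 0 (d j - b (Suc i)))"
    unfolding load_def using False by (simp add: algebra_simps)
  have "load b d i - \<alpha> * (real (i - 1) * D)
      \<le> 1 + \<alpha> * (\<Sum>j\<in>{1..<i}. max 0 (d j - b (Suc i)))"
    unfolding load_def using mult_left_mono[OF sum, of \<alpha>] alpha_pos by (simp add: algebra_simps)
  moreover have "\<alpha> * (real (i - 1) * D) \<le> \<beta> * D"
    using rate_pos'[of "i - 1"] i D mult_right_mono[of "\<alpha> * real (i - 1)" \<beta> D] by simp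
  moreover have "gap b i (d i) = load b d i" using di unfolding balanced_def by simp
  ultimately have "gap b (Suc i) (d i) \<le> load b d (Suc i)" unfolding g l by linarith
  also have "\<dots> = gap b (Suc i) (d (Suc i))" using ds unfolding balanced_def by simp
  finally show ?thesis using gap_less_iff[of "Suc i" b "d (Suc i)" "d i"] by simp
qed

lemma balanced_mono:
  assumes b: "mono_on {1..N} b" and n: "n \<le> N" and d: "\<forall>i\<in>{1..n}. balanced b d i"
  shows "mono_on {1..n} d"
proof (rule mono_onI)
  fix i j assume ij: "i \<in> {1..n}" "j \<in> {1..n}" "i \<le> j"
  have "j \<in> {1..n} \<longrightarrow> d i \<le> d j"
    using ij(3)
  proof (induction j rule: dec_induct)
    case base
    then show ?case by simp
  next
    case (step m)
    then show ?case using balanced_Suc_le[OF b, of m d] d n ij by fastforce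
  qed
  then show "d i \<le> d j" using ij by simp
qed

section \<open>From the integral equations to the balance equations\<close>

definition workload :: "(nat \<Rightarrow> real) \<Rightarrow> (nat \<Rightarrow> real) \<Rightarrow> nat \<Rightarrow> real" where
  "workload a d i =
    (\<beta> + \<alpha>) * (d i - a i) - \<alpha> * (\<Sum>j\<in>{1..N}. overlap (a i) (d i) (a j) (d j))"

lemma is_departure_vector_iff:
  "is_departure_vector N \<alpha> \<beta> a d \<longleftrightarrow> (\<forall>i\<in>{1..N}. a i \<le> d i \<and> workload a d i = 1)"
proof -
  have "integral {a i..d i} (\<lambda>t. \<beta> - \<alpha> * ((\<Sum>j=1..N. indicat_real {a j..d j} t) - 1))
      = workload a d i" if "a i \<le> d i" for i
  proof (rule integral_unique)
    \<comment> \<open>The number of users present is reduced by 1 in the integrand, which leaves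
      \<beta> + \<alpha> as the constant part.\<close>
    have "((\<lambda>t. (\<beta> + \<alpha>) - \<alpha> * (\<Sum>j=1..N. indicat_real {a j..d j} t)) has_integral
        (\<beta> + \<alpha>) * (d i - a i) - \<alpha> * (\<Sum>j=1..N. overlap (a i) (d i) (a j) (d j))) {a i..d i}"
      using has_integral_const_real[of "\<beta> + \<alpha>" "a i" "d i"] that
      by (intro has_integral_diff has_integral_mult_right has_integral_sum
          has_integral_indicator_overlap) (auto simp: mult.commute)
    then show "((\<lambda>t. \<beta> - \<alpha> * ((\<Sum>j=1..N. indicat_real {a j..d j} t) - 1)) has_integral
        workload a d i) {a i..d i}"
      unfolding workload_def by (simp add: algebra_simps)
  qed
  then show ?thesis unfolding is_departure_vector_def by (metis (no_types, lifting))
qed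

text \<open>Every user is served at the same rate, so a sojourn strictly inside another one
  would receive less service.\<close>

lemma departure_order:
  assumes d: "is_departure_vector N \<alpha> \<beta> a d" and ij: "i \<in> {1..N}" "j \<in> {1..N}" "a i \<le> a j"
  shows "d i \<le> d j"
proof (rule ccontr)
  assume less: "\<not> d i \<le> d j"
  define E where "E = (d i - a i) - (d j - a j)"
  have E: "0 < E" using less ij unfolding E_def by linarith
  have le: "a i \<le> d i" "a j \<le> d j" and w: "workload a d i = workload a d j"
    using d ij unfolding is_departure_vector_iff by auto
  \<comment> \<open>The sojourn of \<open>j\<close> lies inside that of \<open>i\<close>, so each
    overlap grows by at most the excess length \<open>E\<close> when passing to the outer
    one.\<close>
  have "(\<Sum>m\<in>{1..N}. overlap (a i) (d i) (a m) (d m) - overlap (a j) (d j) (a m) (d m))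
      \<le> (\<Sum>m\<in>{1..N}. E)"
    using less ij le unfolding overlap_def E_def by (intro sum_mono) linarith
  then have "\<alpha> * ((\<Sum>m\<in>{1..N}. overlap (a i) (d i) (a m) (d m))
      - (\<Sum>m\<in>{1..N}. overlap (a j) (d j) (a m) (d m))) \<le> \<alpha> * (real N * E)"
    using alpha_pos by (intro mult_left_mono) (auto simp: sum_subtractf)
  then have "(\<beta> + \<alpha>) * E \<le> \<alpha> * (real N * E)"
    using w unfolding workload_def E_def by (simp add: algebra_simps)
  then have "(\<beta> - \<alpha> * (real N - 1)) * E \<le> 0" by (simp add: algebra_simps)
  then show False using E rate_pos by (simp add: mult_le_0_iff)
qed

text \<open>The overlap of a user with itself turns the factor \<beta> + \<alpha> into \<beta>; the
  pairs with j < i form \<open>load\<close> and those with j > i form \<open>gap\<close>. Being an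
  identity, it serves both directions of the next equivalence.\<close>

lemma workload_eq_balance:
  assumes s: "bij_betw \<sigma> {1..N} {1..N}" and b: "mono_on {1..N} (\<lambda>i. a (\<sigma> i))"
    and d: "mono_on {1..N} (\<lambda>i. d (\<sigma> i))" and le: "\<forall>i\<in>{1..N}. a (\<sigma> i) \<le> d (\<sigma> i)"
    and i: "i \<in> {1..N}"
  shows "workload a d (\<sigma> i) - 1
    = gap (\<lambda>i. a (\<sigma> i)) i (d (\<sigma> i)) - load (\<lambda>i. a (\<sigma> i)) (\<lambda>i. d (\<sigma> i)) i"
proof -
  have split: "{1..N} = {1..<i} \<union> insert i {i<..N}" using i by auto
  have "(\<Sum>j\<in>{1..N}. overlap (a (\<sigma> i)) (d (\<sigma> i)) (a j) (d j))
      = (\<Sum>j\<in>{1..N}. overlap (a (\<sigma> i)) (d (\<sigma> i)) (a (\<sigma> j)) (d (\<sigma> j)))"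
    using sum.reindex_bij_betw[OF s] by (rule sym)
  also have "\<dots> = (\<Sum>j\<in>{1..<i} \<union> insert i {i<..N}.
      overlap (a (\<sigma> i)) (d (\<sigma> i)) (a (\<sigma> j)) (d (\<sigma> j)))"
    by (simp only: split)
  also have "\<dots> = (\<Sum>j\<in>{1..<i}. overlap (a (\<sigma> i)) (d (\<sigma> i)) (a (\<sigma> j)) (d (\<sigma> j)))
      + (overlap (a (\<sigma> i)) (d (\<sigma> i)) (a (\<sigma> i)) (d (\<sigma> i))
      + (\<Sum>j\<in>{i<..N}. overlap (a (\<sigma> i)) (d (\<sigma> i)) (a (\<sigma> j)) (d (\<sigma> j))))"
    by (subst sum.union_disjoint) auto
  also have "overlap (a (\<sigma> i)) (d (\<sigma> i)) (a (\<sigma> i)) (d (\<sigma> i)) = d (\<sigma> i) - a (\<sigma> i)"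
    using le i by (auto simp: overlap_def)
  also have "(\<Sum>j\<in>{1..<i}. overlap (a (\<sigma> i)) (d (\<sigma> i)) (a (\<sigma> j)) (d (\<sigma> j)))
      = (\<Sum>j\<in>{1..<i}. max 0 (d (\<sigma> j) - a (\<sigma> i)))"
    using i mono_on_intervalD[OF b, of _ i] mono_on_intervalD[OF d, of _ i]
    by (intro sum.cong) (auto simp: overlap_def min_absorb2 max_absorb1)
  also have "(\<Sum>j\<in>{i<..N}. overlap (a (\<sigma> i)) (d (\<sigma> i)) (a (\<sigma> j)) (d (\<sigma> j)))
      = (\<Sum>j\<in>{i<..N}. max 0 (d (\<sigma> i) - a (\<sigma> j)))"
    using i mono_on_intervalD[OF b, of i] mono_on_intervalD[OF d, of i]
    by (intro sum.cong) (auto simp: overlap_def min_absorb1 max_absorb2)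
  finally show ?thesis
    unfolding workload_def gap_def load_def by (simp only:) (simp add: algebra_simps)
qed

text \<open>The identity presupposes increasing departures. Coming from the integrals, these are
  supplied by \<open>departure_order\<close>; coming from the balance equations, by
  \<open>balanced_mono\<close>.\<close>

lemma is_departure_vector_iff_balanced:
  assumes s: "bij_betw \<sigma> {1..N} {1..N}" and b: "mono_on {1..N} (\<lambda>i. a (\<sigma> i))"
  shows "is_departure_vector N \<alpha> \<beta> a d
    \<longleftrightarrow> (\<forall>i\<in>{1..N}. balanced (\<lambda>i. a (\<sigma> i)) (\<lambda>i. d (\<sigma> i)) i)" (is "?L \<longleftrightarrow> ?R")
proof
  have im: "\<sigma> i \<in> {1..N}" if "i \<in> {1..N}" for i using s that bij_betwE by blast
  assume L: ?L
  then have L': "a (\<sigma> i) \<le> d (\<sigma> i)" "workload a d (\<sigma> i) = 1" if "i \<in> {1..N}" for i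
    using im[OF that] unfolding is_departure_vector_iff by simp_all
  have "mono_on {1..N} (\<lambda>i. d (\<sigma> i))"
    using im by (intro mono_onI departure_order[OF L] mono_onD[OF b]) auto
  from workload_eq_balance[OF s b this] L' show ?R
    unfolding balanced_def by simp
next
  assume R: ?R
  have le: "\<forall>i\<in>{1..N}. a (\<sigma> i) \<le> d (\<sigma> i)" using R unfolding balanced_def by auto
  have "a (\<sigma> i) \<le> d (\<sigma> i) \<and> workload a d (\<sigma> i) = 1" if "i \<in> {1..N}" for i
    using workload_eq_balance[OF s b balanced_mono[OF b order_refl R] le that] R that
    unfolding balanced_def by auto
  then have "\<forall>i\<in>\<sigma> ` {1..N}. a i \<le> d i \<and> workload a d i = 1" by blast
  then show ?L unfolding is_departure_vector_iff bij_betw_imp_surj_on[OF s] .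
qed

lemma departures_balanced:
  assumes s: "bij_betw \<sigma> {1..N} {1..N}" and b: "mono_on {1..N} (\<lambda>i. a (\<sigma> i))"
  shows "\<forall>i\<in>{1..N}. balanced (\<lambda>i. a (\<sigma> i)) (\<lambda>i. departures N \<alpha> \<beta> a (\<sigma> i)) i"
proof -
  note iff = is_departure_vector_iff_balanced[OF s b]
  have inv: "inv_into {1..N} \<sigma> (\<sigma> i) = i" if "i \<in> {1..N}" for i
    using s that by (simp add: bij_betw_inv_into_left)
  have cong: "balanced c d i = balanced c e i" if "\<forall>j\<in>{1..i}. d j = e j" "i \<in> {1..N}" for c d e i
  proof -
    have "load c d i = load c e i" unfolding load_def using that by (auto intro!: sum.cong)
    then show ?thesis using that unfolding balanced_def by auto
  qed
  obtain d where d: "\<forall>i\<in>{1..N}. balanced (\<lambda>i. a (\<sigma> i)) d i"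
    using balanced_exists[OF b order_refl] by blast
  \<comment> \<open>Back from positions to users; the restriction makes the vector
    extensional.\<close>
  define e where "e = restrict (\<lambda>u. d (inv_into {1..N} \<sigma> u)) {1..N}"
  have im: "\<sigma> i \<in> {1..N}" if "i \<in> {1..N}" for i using s that bij_betwE by blast
  have e_eq: "e (\<sigma> i) = d i" if "i \<in> {1..N}" for i
    using im[OF that] inv[OF that] by (simp add: e_def)
  have "balanced (\<lambda>i. a (\<sigma> i)) (\<lambda>i. e (\<sigma> i)) i" if "i \<in> {1..N}" for i
    using d that e_eq cong[of i "\<lambda>i. e (\<sigma> i)" d "\<lambda>i. a (\<sigma> i)"] by simp
  then have e: "is_departure_vector N \<alpha> \<beta> a e" unfolding iff by blast
  have e_ext: "e \<in> extensional {1..N}" by (simp add: e_def)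
  have uniq: "e' = e" if "e' \<in> extensional {1..N}" "is_departure_vector N \<alpha> \<beta> a e'" for e'
  proof (rule extensionalityI[OF that(1) e_ext])
    fix u assume "u \<in> {1..N}"
    then obtain i where i: "i \<in> {1..N}" and u: "u = \<sigma> i"
      using bij_betw_imp_surj_on[OF s] by (metis imageE)
    show "e' u = e u"
      unfolding u by (rule balanced_unique[OF that(2)[unfolded iff] e[unfolded iff] i])
  qed
  have "departures N \<alpha> \<beta> a = e"
    unfolding departures_def
  proof (rule the_equality)
    show "e \<in> extensional {1..N} \<and> is_departure_vector N \<alpha> \<beta> a e" using e_ext e ..
  qed (elim conjE, rule uniq)
  then show ?thesis using e unfolding iff by simp
qed

end


section \<open>The recursion for departure times and convexity\<close>

lemma hd_filter_upt:
  assumes "P i" "m \<le> i" "i < n"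
  shows "m \<le> hd (filter P [m..<n])" "hd (filter P [m..<n]) < n" "P (hd (filter P [m..<n]))"
    and "\<And>j. m \<le> j \<Longrightarrow> j < hd (filter P [m..<n]) \<Longrightarrow> \<not> P j"
proof -
  have ne: "filter P [m..<n] \<noteq> []" using assms by (auto simp: filter_empty_conv)
  from hd_in_set[OF this]
  show "m \<le> hd (filter P [m..<n])" "hd (filter P [m..<n]) < n" "P (hd (filter P [m..<n]))"
    by auto
  fix j assume j: "m \<le> j" "j < hd (filter P [m..<n])"
  show "\<not> P j"
  proof
    assume "P j"
    then have "j \<in> set (filter P [m..<n])" using j \<open>hd (filter P [m..<n]) < n\<close> by simp
    moreover have "sorted (filter P [m..<n])" by (simp add: sorted_filter[of id, simplified])
    ultimately have "hd (filter P [m..<n]) \<le> j" using ne by (cases "filter P [m..<n]") auto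
    then show False using j by simp
  qed
qed

lemma hvec_props:
  assumes "1 \<le> i"
  shows "1 \<le> hvec k i" "hvec k i \<le> i" "hvec k i = i \<or> i \<le> k (hvec k i)"
    and "\<And>j. 1 \<le> j \<Longrightarrow> j < hvec k i \<Longrightarrow> k j < i"
proof -
  note h = hd_filter_upt[of "\<lambda>h. h = i \<or> i \<le> k h" i 1 "Suc i", folded hvec_def]
  show "1 \<le> hvec k i" "hvec k i \<le> i" "hvec k i = i \<or> i \<le> k (hvec k i)"
    using h(1-3) assms by simp_all
  show "k j < i" if "1 \<le> j" "j < hvec k i" for j
    using h(4)[OF _ _ _ that] assms by (simp add: not_le)
qed

section \<open>The recursion as a linear piece of the balance equation\<close>

context slowdown_system
begin

text \<open>The equation \<open>(\<ast>)\<close> of the paper.\<close>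

definition star :: "(nat \<Rightarrow> nat) \<Rightarrow> (nat \<Rightarrow> real) \<Rightarrow> (nat \<Rightarrow> real) \<Rightarrow> nat \<Rightarrow> bool" where
  "star k b d i \<longleftrightarrow> (\<beta> - \<alpha> * real (k i - i)) * d i
    = 1 + (\<beta> - \<alpha> * real (i - hvec k i)) * b i
      + \<alpha> * ((\<Sum>j=hvec k i..<i. d j) - (\<Sum>j=Suc i..k i. b j))"

text \<open>Both inequalities are weak, so at a tie the two neighbouring values of
  \<open>k i\<close> are both compatible.\<close>

definition compat :: "(nat \<Rightarrow> nat) \<Rightarrow> (nat \<Rightarrow> real) \<Rightarrow> (nat \<Rightarrow> real) \<Rightarrow> nat \<Rightarrow> bool" where
  "compat k b d i \<longleftrightarrow> i \<le> k i \<and> k i \<le> N \<and> b (k i) \<le> d i \<and> (k i < N \<longrightarrow> d i \<le> b (Suc (k i)))"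

text \<open>The linear piece of \<open>gap b i\<close> between the arrivals m and m + 1, continued
  to all of the real line. The continuation matters where \<open>k i\<close> is outdated.\<close>

definition gap_line :: "nat \<Rightarrow> (nat \<Rightarrow> real) \<Rightarrow> nat \<Rightarrow> real \<Rightarrow> real" where
  "gap_line m b i t = (\<beta> - \<alpha> * real (m - i)) * t - \<beta> * b i + \<alpha> * (\<Sum>j=Suc i..m. b j)"

lemma gap_line_pos: "1 \<le> i \<Longrightarrow> m \<le> N \<Longrightarrow> 0 < \<beta> - \<alpha> * real (m - i)"
proof (rule rate_pos')
  assume "1 \<le> i" "m \<le> N"
  then have "m - i + 1 \<le> N" using N_pos by arith
  then have "real (m - i + 1) \<le> real N" by (rule of_nat_mono)
  then show "real (m - i) \<le> real N - 1" by simp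
qed

lemma gap_line_less_iff:
  "1 \<le> i \<Longrightarrow> m \<le> N \<Longrightarrow> gap_line m b i s < gap_line m b i t \<longleftrightarrow> s < t"
  using gap_line_pos[of i m] by (simp add: gap_line_def)

lemma gap_eq_line:
  assumes b: "mono_on {1..N} b" and i: "1 \<le> i" "i \<le> m" "m \<le> N"
    and t: "b m \<le> t" "m < N \<Longrightarrow> t \<le> b (Suc m)"
  shows "gap b i t = gap_line m b i t"
proof -
  have split: "{i<..N} = {Suc i..m} \<union> {m<..N}" using i by auto
  have "(\<Sum>j\<in>{m<..N}. max 0 (t - b j)) = 0"
  proof (intro sum.neutral ballI)
    fix j assume "j \<in> {m<..N}"
    then show "max 0 (t - b j) = 0"
      using t mono_on_intervalD[OF b, of "Suc m" j] by simp
  qed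
  moreover have "(\<Sum>j=Suc i..m. max 0 (t - b j)) = (\<Sum>j=Suc i..m. t - b j)"
  proof (intro sum.cong refl)
    fix j assume "j \<in> {Suc i..m}"
    then show "max 0 (t - b j) = t - b j"
      using t i mono_on_intervalD[OF b, of j m] by simp
  qed
  ultimately have "(\<Sum>j\<in>{i<..N}. max 0 (t - b j)) = (\<Sum>j=Suc i..m. t - b j)"
    unfolding split by (subst sum.union_disjoint) auto
  then show ?thesis
    unfolding gap_def gap_line_def by (simp only:) (simp add: sum_subtractf algebra_simps)
qed

text \<open>For j < h_i, the departure j is not after the arrival following \<open>k j\<close>,
  hence not after \<open>b i\<close>. For later j, monotonicity gives \<open>d j\<close> \<ge>
  \<open>d (hvec k i)\<close> \<ge> \<open>b i\<close>. A tie contributes 0 either way.\<close>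

lemma load_eq:
  assumes b: "mono_on {1..N} b" and i: "1 \<le> i" "i \<le> N"
    and d: "mono_on {1..i - 1} d" and k: "\<forall>j\<in>{1..<i}. compat k b d j"
  shows "load b d i = 1 + \<alpha> * ((\<Sum>j=hvec k i..<i. d j) - real (i - hvec k i) * b i)"
proof -
  note h = hvec_props[OF i(1), where k = k]
  have split: "{1..<i} = {1..<hvec k i} \<union> {hvec k i..<i}" using h by auto
  have "(\<Sum>j\<in>{1..<hvec k i}. max 0 (d j - b i)) = 0"
  proof (intro sum.neutral ballI)
    fix j assume j: "j \<in> {1..<hvec k i}"
    then have "k j < i" using h by auto
    moreover have "compat k b d j" using j h k by auto
    ultimately show "max 0 (d j - b i) = 0"
      using i mono_on_intervalD[OF b, of "Suc (k j)" i] unfolding compat_def by auto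
  qed
  moreover have "(\<Sum>j=hvec k i..<i. max 0 (d j - b i)) = (\<Sum>j=hvec k i..<i. d j - b i)"
  proof (intro sum.cong refl)
    fix j assume j: "j \<in> {hvec k i..<i}"
    then have "i \<le> k (hvec k i)" "compat k b d (hvec k i)" using h k by auto
    then have "b i \<le> d (hvec k i)"
      using i mono_on_intervalD[OF b, of i "k (hvec k i)"] unfolding compat_def by auto
    also have "\<dots> \<le> d j" using j h by (intro mono_on_intervalD[OF d]) auto
    finally show "max 0 (d j - b i) = d j - b i" by simp
  qed
  ultimately have "(\<Sum>j\<in>{1..<i}. max 0 (d j - b i)) = (\<Sum>j=hvec k i..<i. d j - b i)"
    unfolding split by (subst sum.union_disjoint) auto
  then show ?thesis unfolding load_def by (simp add: sum_subtractf)
qed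

text \<open>Compatibility is assumed for the departures before i only. The equation of i can thus be
  exploited where \<open>k i\<close> itself has become wrong, which is the situation right of an
  event of i.\<close>

lemma star_iff_line:
  assumes "mono_on {1..N} b" "1 \<le> i" "i \<le> N"
    and "mono_on {1..i - 1} d" "\<forall>j\<in>{1..<i}. compat k b d j"
  shows "star k b d i \<longleftrightarrow> gap_line (k i) b i (d i) = load b d i"
  unfolding load_eq[OF assms] star_def gap_line_def by (auto simp: algebra_simps)

lemma compat_le:
  "mono_on {1..N} b \<Longrightarrow> 1 \<le> i \<Longrightarrow> compat k b d i \<Longrightarrow> b i \<le> d i"
  unfolding compat_def using mono_on_intervalD[of N b i "k i"] by auto

lemma compat_gap:
  assumes "mono_on {1..N} b" "1 \<le> i" "compat k b d i"
  shows "gap b i (d i) = gap_line (k i) b i (d i)"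
  using assms by (intro gap_eq_line) (auto simp: compat_def)

lemma star_iff_balanced:
  assumes b: "mono_on {1..N} b" and i: "1 \<le> i" "i \<le> N"
    and bal: "\<forall>j\<in>{1..<i}. balanced b d j" and k: "\<forall>j\<in>{1..i}. compat k b d j"
  shows "star k b d i \<longleftrightarrow> balanced b d i"
proof -
  have "{1..i - 1} = {1..<i}" by auto
  then have d: "mono_on {1..i - 1} d" using i bal by (intro balanced_mono[OF b]) auto
  have "\<forall>j\<in>{1..<i}. compat k b d j" using k by auto
  note star_iff_line[OF b i d this]
  moreover have "compat k b d i" using k i by simp
  ultimately show ?thesis
    using compat_gap[OF b i(1)] compat_le[OF b i(1)] unfolding balanced_def by simp
qed

lemma balanced_imp_star:
  assumes b: "mono_on {1..N} b" and bal: "\<forall>i\<in>{1..N}. balanced b d i"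
    and k: "\<forall>i\<in>{1..N}. compat k b d i" and i: "i \<in> {1..N}"
  shows "star k b d i"
  using star_iff_balanced[OF b, of i d k] assms by auto

text \<open>As \<open>hvec\<close> depends on \<open>k\<close> alone, \<open>star\<close> is for
  fixed \<open>k\<close> a triangular linear system with positive diagonal.\<close>

lemma star_unique:
  assumes d: "\<forall>i\<in>{1..n}. star k b d i" and e: "\<forall>i\<in>{1..n}. star k b e i"
    and k: "\<forall>i\<in>{1..n}. k i \<le> N" and i: "i \<in> {1..n}"
  shows "d i = e i"
  using i
proof (induction i rule: less_induct)
  case (less i)
  then have "(\<Sum>j=hvec k i..<i. d j) = (\<Sum>j=hvec k i..<i. e j)"
    using hvec_props[of i, where k = k] by (intro sum.cong) auto
  moreover have "star k b d i" "star k b e i" using d e less.prems by auto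
  ultimately have "(\<beta> - \<alpha> * real (k i - i)) * d i = (\<beta> - \<alpha> * real (k i - i)) * e i"
    unfolding star_def by simp
  then show ?case using gap_line_pos[of i "k i"] k less.prems by simp
qed

end

section \<open>Convexity of the departures in the moving arrival time\<close>

lemma max_0_convex_combination:
  fixes p q r u v :: real
  assumes "0 \<le> u" "0 \<le> v" "r \<le> u * p + v * q"
  shows "max 0 r \<le> u * max 0 p + v * max 0 q"
  using assms mult_left_mono[of p "max 0 p" u] mult_left_mono[of q "max 0 q" v]
  by (smt (verit) mult_nonneg_nonneg)

text \<open>On an interval on which the order of arrivals does not change, the arrival at position \<open>i\<close> is
  \<open>\<phi> i * x + \<zeta> i\<close> and the true departures are \<open>D x i\<close>.\<close>

locale arrival_order = slowdown_system +
  fixes \<phi> \<zeta> :: "nat \<Rightarrow> real" and D :: "real \<Rightarrow> nat \<Rightarrow> real" and l R :: real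
  assumes arrivals_mono: "x \<in> {l..R} \<Longrightarrow> mono_on {1..N} (\<lambda>i. \<phi> i * x + \<zeta> i)"
    and D_balanced: "x \<in> {l..R} \<Longrightarrow> i \<in> {1..N} \<Longrightarrow> balanced (\<lambda>i. \<phi> i * x + \<zeta> i) (D x) i"
begin

definition arr :: "real \<Rightarrow> nat \<Rightarrow> real" where
  "arr x i = \<phi> i * x + \<zeta> i"

lemma arr_mono: "x \<in> {l..R} \<Longrightarrow> mono_on {1..N} (arr x)"
  using arrivals_mono unfolding arr_def .

lemma arr_D: "x \<in> {l..R} \<Longrightarrow> i \<in> {1..N} \<Longrightarrow> balanced (arr x) (D x) i"
  using D_balanced unfolding arr_def .

text \<open>The departure at position \<open>i\<close> is the smallest \<open>t\<close> with \<open>gap (arr x) i t \<ge> load (arr x) (D x) i\<close>, where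
  the left-hand side is jointly concave in \<open>t\<close> and \<open>x\<close> and the right-hand side is convex in \<open>x\<close>.\<close>

lemma D_convex:
  assumes x: "x \<in> {l..R}" and y: "y \<in> {l..R}" and uv: "0 \<le> u" "0 \<le> v" "u + v = 1"
    and i: "i \<in> {1..N}"
  shows "D (u * x + v * y) i \<le> u * D x i + v * D y i"
  using i
proof (induction i rule: less_induct)
  case (less i)
  define z where "z = u * x + v * y"
  have z: "z \<in> {l..R}"
    using x y uv convex_real_interval(5)[of l R] unfolding convex_def z_def by simp
  have arr: "arr z j = u * arr x j + v * arr y j" for j
  proof -
    have "\<zeta> j = (u + v) * \<zeta> j" using uv by simp
    then show ?thesis unfolding arr_def z_def by (simp add: algebra_simps)
  qed
  have "(\<Sum>j\<in>{1..<i}. max 0 (D z j - arr z i))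
      \<le> (\<Sum>j\<in>{1..<i}. u * max 0 (D x j - arr x i) + v * max 0 (D y j - arr y i))"
  proof (rule sum_mono)
    fix j assume "j \<in> {1..<i}"
    then have "D z j \<le> u * D x j + v * D y j" using less unfolding z_def by simp
    then show "max 0 (D z j - arr z i) \<le> u * max 0 (D x j - arr x i) + v * max 0 (D y j - arr y i)"
      using uv by (intro max_0_convex_combination) (auto simp: arr algebra_simps)
  qed
  also have "\<dots> = u * (\<Sum>j\<in>{1..<i}. max 0 (D x j - arr x i))
      + v * (\<Sum>j\<in>{1..<i}. max 0 (D y j - arr y i))"
    by (simp add: sum.distrib sum_distrib_left)
  finally have "load (arr z) (D z) i
      \<le> (u + v) + \<alpha> * (u * (\<Sum>j\<in>{1..<i}. max 0 (D x j - arr x i))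
      + v * (\<Sum>j\<in>{1..<i}. max 0 (D y j - arr y i)))"
    unfolding load_def uv using alpha_pos by simp
  also have "\<dots> = u * load (arr x) (D x) i + v * load (arr y) (D y) i"
    unfolding load_def by (simp add: algebra_simps)
  also have "\<dots> = u * gap (arr x) i (D x i) + v * gap (arr y) i (D y i)"
    using arr_D x y less.prems unfolding balanced_def by metis
  finally have 1: "gap (arr z) i (D z i) \<le> u * gap (arr x) i (D x i) + v * gap (arr y) i (D y i)"
    using arr_D[OF z less.prems] unfolding balanced_def by simp
  define t where "t = u * D x i + v * D y i"
  have "(\<Sum>j\<in>{i<..N}. max 0 (t - arr z j))
      \<le> (\<Sum>j\<in>{i<..N}. u * max 0 (D x i - arr x j) + v * max 0 (D y i - arr y j))"
    using uv by (intro sum_mono max_0_convex_combination) (auto simp: t_def arr algebra_simps)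
  also have "\<dots> = u * (\<Sum>j\<in>{i<..N}. max 0 (D x i - arr x j))
      + v * (\<Sum>j\<in>{i<..N}. max 0 (D y i - arr y j))"
    by (simp add: sum.distrib sum_distrib_left)
  finally have "\<alpha> * (\<Sum>j\<in>{i<..N}. max 0 (t - arr z j))
      \<le> \<alpha> * (u * (\<Sum>j\<in>{i<..N}. max 0 (D x i - arr x j))
      + v * (\<Sum>j\<in>{i<..N}. max 0 (D y i - arr y j)))"
    using alpha_pos by simp
  then have "u * gap (arr x) i (D x i) + v * gap (arr y) i (D y i) \<le> gap (arr z) i t"
    unfolding gap_def by (simp add: t_def arr algebra_simps)
  with 1 have "gap (arr z) i (D z i) \<le> gap (arr z) i t" by simp
  then show ?case
    using gap_less_iff[of i "arr z" t "D z i"] less.prems unfolding z_def t_def by simp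
qed

text \<open>The distance from the arrival line to the departure is convex and vanishes at
  \<open>x\<close>. Once positive, it cannot come back to zero.\<close>

lemma overtaken_for_good:
  assumes x: "x \<in> {l..R}" and y: "y \<in> {x<..R}" and i: "i \<in> {1..N}"
    and meet: "D x i = arr x j"
    and above: "arr y j < D y i" and z: "z \<in> {y..R}"
  shows "arr z j < D z i"
proof -
  define v where "v = (y - x) / (z - x)"
  have v: "0 < v" "v \<le> 1" using y z unfolding v_def by auto
  have y_eq: "y = (1 - v) * x + v * z"
  proof -
    have "v * (z - x) = y - x" using y z unfolding v_def by simp
    then show ?thesis by (simp add: algebra_simps)
  qed
  have "D y i \<le> (1 - v) * D x i + v * D z i"
    using D_convex[of x z "1 - v" v i] x y z v i unfolding y_eq[symmetric] by simp
  moreover have "arr y j = (1 - v) * arr x j + v * arr z j"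
    unfolding arr_def y_eq by (simp add: algebra_simps)
  ultimately have "v * arr z j < v * D z i" using meet above by simp
  then show ?thesis using v by simp
qed

end


section \<open>Events on an interval\<close>

text \<open>The result of \<open>departure_events\<close> without the counter.\<close>

definition departure_event_list ::
  "nat \<Rightarrow> (nat \<Rightarrow> nat) \<Rightarrow> (nat \<Rightarrow> real) \<Rightarrow> (nat \<Rightarrow> real) \<Rightarrow> (nat \<Rightarrow> real) \<Rightarrow> (nat \<Rightarrow> real) \<Rightarrow> nat
    \<Rightarrow> (real \<times> event) list" where
  "departure_event_list N k \<phi> \<zeta> \<theta> \<eta> i =
    (if k i < N \<and> \<phi> (Suc (k i)) < \<theta> i
     then [((\<zeta> (Suc (k i)) - \<eta> i) / (\<theta> i - \<phi> (Suc (k i))), Departure_Up i)] else []) @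
    (if i < k i \<and> \<theta> i < \<phi> (k i)
     then [((\<zeta> (k i) - \<eta> i) / (\<theta> i - \<phi> (k i)), Departure_Down i)] else [])"

text \<open>The lines solve \<open>star\<close> for every real x, but \<open>k\<close> is known to
  be compatible only at the left end. How far to the right the lines are the true departures is to
  be derived from the events.\<close>

locale search_interval = arrival_order +
  fixes \<theta> \<eta> :: "nat \<Rightarrow> real" and k :: "nat \<Rightarrow> nat"
  assumes l_le_R: "l \<le> R"
    and star_line: "i \<in> {1..N} \<Longrightarrow> star k (\<lambda>i. \<phi> i * x + \<zeta> i) (\<lambda>i. \<theta> i * x + \<eta> i) i"
    and compat_l: "i \<in> {1..N} \<Longrightarrow> compat k (\<lambda>i. \<phi> i * l + \<zeta> i) (D l) i"
begin

definition dep :: "real \<Rightarrow> nat \<Rightarrow> real" where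
  "dep x i = \<theta> i * x + \<eta> i"

abbreviation events :: "nat \<Rightarrow> (real \<times> event) list" where
  "events \<equiv> departure_event_list N k \<phi> \<zeta> \<theta> \<eta>"

lemma star_dep: "i \<in> {1..N} \<Longrightarrow> star k (arr x) (dep x) i"
  using star_line unfolding arr_def dep_def .

lemma compat_D: "i \<in> {1..N} \<Longrightarrow> compat k (arr l) (D l) i"
  using compat_l unfolding arr_def .

lemma l_in: "l \<in> {l..R}"
  using l_le_R by simp

lemma k_bounds: "i \<in> {1..N} \<Longrightarrow> i \<le> k i \<and> k i \<le> N"
  using compat_D unfolding compat_def by blast

text \<open>At \<open>l\<close> the true departures also solve \<open>star\<close>, since
  \<open>k\<close> is compatible there, and the solution is unique.\<close>

lemma dep_l: "i \<in> {1..N} \<Longrightarrow> dep l i = D l i"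
  using star_unique[of N k "arr l" "dep l" "D l" i] star_dep k_bounds
    balanced_imp_star[OF arr_mono[OF l_in], of "D l" k] arr_D[OF l_in] compat_D
  by blast

text \<open>Either the departure line is steeper than the arrival line, and then the event time is
  their crossing, or the inequality at \<open>l\<close> persists.\<close>

lemma upper_bound:
  assumes "i \<in> {1..N}" "l \<le> x" "k i < N"
    and "\<And>t. (t, Departure_Up i) \<in> set (events i) \<Longrightarrow> x \<le> t"
  shows "dep x i \<le> arr x (Suc (k i))"
proof (cases "\<phi> (Suc (k i)) < \<theta> i")
  case True
  then have "x \<le> (\<zeta> (Suc (k i)) - \<eta> i) / (\<theta> i - \<phi> (Suc (k i)))"
    using assms by (intro assms(4)) (auto simp: departure_event_list_def)
  then show ?thesis using True unfolding dep_def arr_def by (simp add: field_simps)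
next
  case False
  have "dep l i \<le> arr l (Suc (k i))"
    using assms compat_D[of i] dep_l[of i] unfolding compat_def by auto
  moreover have "\<theta> i * (x - l) \<le> \<phi> (Suc (k i)) * (x - l)"
    using False assms by (intro mult_right_mono) auto
  ultimately show ?thesis unfolding dep_def arr_def by (simp add: algebra_simps)
qed

lemma lower_bound:
  assumes "i \<in> {1..N}" "l \<le> x" "i < k i"
    and "\<And>t. (t, Departure_Down i) \<in> set (events i) \<Longrightarrow> x \<le> t"
  shows "arr x (k i) \<le> dep x i"
proof (cases "\<theta> i < \<phi> (k i)")
  case True
  then have "x \<le> (\<zeta> (k i) - \<eta> i) / (\<theta> i - \<phi> (k i))"
    using assms by (intro assms(4)) (auto simp: departure_event_list_def)
  then show ?thesis using True unfolding dep_def arr_def by (simp add: field_simps)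
next
  case False
  have "arr l (k i) \<le> dep l i"
    using assms compat_D[of i] dep_l[of i] unfolding compat_def by auto
  moreover have "\<phi> (k i) * (x - l) \<le> \<theta> i * (x - l)"
    using False assms by (intro mult_right_mono) auto
  ultimately show ?thesis unfolding dep_def arr_def by (simp add: algebra_simps)
qed

lemma event_time_ge_l:
  assumes "i \<in> {1..N}" "(t, e) \<in> set (events i)"
  shows "l \<le> t"
proof -
  have "compat k (arr l) (dep l) i" using compat_D[of i] dep_l[of i] assms by (simp add: compat_def)
  then show ?thesis
    using assms(2) unfolding compat_def departure_event_list_def dep_def arr_def
    by (auto simp: field_simps split: if_splits)
qed

text \<open>The bounds give compatibility of departure i, and with the earlier departures already
  balanced \<open>star\<close> becomes the balance equation. Stating it for a prefix of positions
  keeps it usable when a later departure already has its event.\<close>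

lemma dep_compat_balanced:
  assumes x: "x \<in> {l..R}" and n: "n \<le> N"
    and ev: "\<forall>i\<in>{1..n}. \<forall>(t, e)\<in>set (events i). x \<le> t"
  shows "\<forall>i\<in>{1..n}. compat k (arr x) (dep x) i \<and> balanced (arr x) (dep x) i"
  using n ev
proof (induction n)
  case 0
  then show ?case by simp
next
  case (Suc n)
  note b = arr_mono[OF x]
  let ?i = "Suc n"
  have "\<forall>i\<in>{1..n}. compat k (arr x) (dep x) i \<and> balanced (arr x) (dep x) i"
    using Suc.prems by (intro Suc.IH) auto
  then have IH: "\<forall>i\<in>{1..<?i}. compat k (arr x) (dep x) i \<and> balanced (arr x) (dep x) i"
    by simp
  have i: "?i \<in> {1..N}" using Suc.prems by simp
  have lo: "arr x (k ?i) \<le> dep x ?i"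
  proof (cases "?i < k ?i")
    case True
    then show ?thesis using i x Suc.prems(2) by (intro lower_bound) auto
  next
    case False
    \<comment> \<open>No event watches a departure against its own arrival; here the load of at
      least 1 rules out a crossing.\<close>
    then have k: "k ?i = ?i" using k_bounds[OF i] by simp
    have "gap_line (k ?i) (arr x) ?i (dep x ?i) = load (arr x) (dep x) ?i"
      using star_iff_line[OF b, of ?i "dep x" k] star_dep[OF i, of x] i IH
        balanced_mono[OF b, of n "dep x"] by auto
    then have "\<beta> * (dep x ?i - arr x ?i) \<ge> 1"
      using load_ge_1[of "arr x" "dep x" ?i] unfolding k gap_line_def by (simp add: algebra_simps)
    then have "0 < \<beta> * (dep x ?i - arr x ?i)" by linarith
    then show ?thesis
      using rate_pos'[of 0] N_pos unfolding k by (simp add: zero_less_mult_iff)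
  qed
  have up: "k ?i < N \<longrightarrow> dep x ?i \<le> arr x (Suc (k ?i))"
    using i x Suc.prems(2) by (intro impI upper_bound) auto
  have c: "compat k (arr x) (dep x) ?i"
    using lo up k_bounds[OF i] unfolding compat_def by simp
  have "\<forall>j\<in>{1..?i}. compat k (arr x) (dep x) j" using IH c by (auto simp: le_Suc_eq)
  then have "balanced (arr x) (dep x) ?i"
    using star_iff_balanced[OF b, of ?i "dep x" k] star_dep[OF i] i IH by auto
  then show ?case using IH c by (auto simp: le_Suc_eq)
qed

lemma dep_eq_D:
  assumes x: "x \<in> {l..R}" and n: "n \<le> N"
    and ev: "\<forall>i\<in>{1..n}. \<forall>(t, e)\<in>set (events i). x \<le> t"
    and i: "i \<in> {1..n}"
  shows "dep x i = D x i"
  using balanced_unique[of n "arr x" "dep x" "D x" i] dep_compat_balanced[OF x n ev] arr_D[OF x] n i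
  by auto

text \<open>Right of an event of departure \<open>i\<close>, the departures before \<open>i\<close> still follow their lines. This
  suffices to decide on which side of the arrival met by departure \<open>i\<close> the true departure is.\<close>

lemma load_after_event:
  assumes i: "i \<in> {1..N}" and x: "x \<in> {l..R}"
    and ev: "\<forall>j\<in>{1..<i}. \<forall>(t, e)\<in>set (events j). x \<le> t"
  shows "gap_line (k i) (arr x) i (dep x i) = gap (arr x) i (D x i)"
proof -
  note b = arr_mono[OF x]
  have set_eq: "{1..<i} = {1..i - 1}" by auto
  note ev' = ev[unfolded set_eq]
  have n: "i - 1 \<le> N" using i by auto
  have *: "\<forall>j\<in>{1..i - 1}. compat k (arr x) (dep x) j \<and> balanced (arr x) (dep x) j"
    using dep_compat_balanced[OF x n ev'] by blast
  then have "gap_line (k i) (arr x) i (dep x i) = load (arr x) (dep x) i"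
    using star_iff_line[OF b, of i "dep x" k] star_dep[OF i, of x] i
      balanced_mono[OF b n, of "dep x"] unfolding set_eq by simp
  also have "\<dots> = load (arr x) (D x) i"
    using dep_eq_D[OF x n ev'] unfolding load_def by (auto intro!: sum.cong)
  also have "\<dots> = gap (arr x) i (D x i)"
    using arr_D[OF x i] unfolding balanced_def by simp
  finally show ?thesis .
qed

text \<open>Right of \<open>t\<close> the line has passed the arrival that ends its linear piece.
  There \<open>gap\<close> and \<open>gap_line\<close> agree, and \<open>gap_line\<close> at the
  line's value equals \<open>gap\<close> at the true departure. So monotonicity carries the strict
  inequality over, although line and true departure may differ.\<close>

lemma after_Departure_Up:
  assumes i: "i \<in> {1..N}" and e: "(t, Departure_Up i) \<in> set (events i)"
    and x: "x \<in> {l..R}" "t < x"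
    and ev: "\<forall>j\<in>{1..<i}. \<forall>(t, e)\<in>set (events j). x \<le> t"
  shows "arr x (Suc (k i)) < D x i"
proof -
  have k: "k i < N" "\<phi> (Suc (k i)) < \<theta> i"
    and t: "t = (\<zeta> (Suc (k i)) - \<eta> i) / (\<theta> i - \<phi> (Suc (k i)))"
    using e unfolding departure_event_list_def by (auto split: if_splits)
  have "arr x (Suc (k i)) < dep x i"
    using k x unfolding t dep_def arr_def by (simp add: field_simps)
  then have "gap_line (k i) (arr x) i (arr x (Suc (k i))) < gap_line (k i) (arr x) i (dep x i)"
    using gap_line_less_iff[of i "k i"] k i by simp
  also note load_after_event[OF i x(1) ev]
  finally have "gap_line (k i) (arr x) i (arr x (Suc (k i))) < gap (arr x) i (D x i)" .
  moreover have "gap (arr x) i (arr x (Suc (k i))) = gap_line (k i) (arr x) i (arr x (Suc (k i)))"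
    using k k_bounds[OF i] i mono_on_intervalD[OF arr_mono[OF x(1)], of "k i" "Suc (k i)"]
    by (intro gap_eq_line[OF arr_mono[OF x(1)]]) auto
  ultimately show ?thesis using gap_less_iff[of i "arr x"] i by (metis atLeastAtMost_iff)
qed

text \<open>The mirror image: the arrival \<open>k i\<close> is the left end of the linear piece,
  where \<open>gap\<close> and \<open>gap_line\<close> agree as well.\<close>

lemma after_Departure_Down:
  assumes i: "i \<in> {1..N}" and e: "(t, Departure_Down i) \<in> set (events i)"
    and x: "x \<in> {l..R}" "t < x"
    and ev: "\<forall>j\<in>{1..<i}. \<forall>(t, e)\<in>set (events j). x \<le> t"
  shows "D x i < arr x (k i)"
proof -
  have k: "i < k i" "\<theta> i < \<phi> (k i)"
    and t: "t = (\<zeta> (k i) - \<eta> i) / (\<theta> i - \<phi> (k i))"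
    using e unfolding departure_event_list_def by (auto split: if_splits)
  have "dep x i < arr x (k i)"
    using k x unfolding t dep_def arr_def by (simp add: field_simps)
  then have "gap_line (k i) (arr x) i (dep x i) < gap_line (k i) (arr x) i (arr x (k i))"
    using gap_line_less_iff[of i "k i"] k_bounds[OF i] i by simp
  then have "gap (arr x) i (D x i) < gap_line (k i) (arr x) i (arr x (k i))"
    unfolding load_after_event[OF i x(1) ev] .
  moreover have "gap (arr x) i (arr x (k i)) = gap_line (k i) (arr x) i (arr x (k i))"
    using k k_bounds[OF i] i mono_on_intervalD[OF arr_mono[OF x(1)], of "k i" "Suc (k i)"]
    by (intro gap_eq_line[OF arr_mono[OF x(1)]]) auto
  ultimately show ?thesis using gap_less_iff[of i "arr x"] i by (metis atLeastAtMost_iff)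
qed

lemma event_meets:
  assumes "i \<in> {1..N}"
  shows "(t, Departure_Up i) \<in> set (events i) \<Longrightarrow> dep t i = arr t (Suc (k i)) \<and> k i < N"
    and "(t, Departure_Down i) \<in> set (events i) \<Longrightarrow> dep t i = arr t (k i) \<and> i < k i"
  unfolding departure_event_list_def dep_def arr_def by (auto simp: field_simps split: if_splits)

end


section \<open>Operation counts\<close>

text \<open>A Hoare triple with a cost. Quantifying over all initial counter values makes costs add
  up under bind.\<close>

definition spec :: "'a counted \<Rightarrow> nat \<Rightarrow> ('a \<Rightarrow> bool) \<Rightarrow> bool" where
  "spec m c P \<longleftrightarrow> (\<forall>n. P (fst (run_state m n)) \<and> snd (run_state m n) \<le> n + c)"

abbreviation computes :: "'a counted \<Rightarrow> nat \<Rightarrow> 'a \<Rightarrow> bool" where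
  "computes m c v \<equiv> spec m c (\<lambda>x. x = v)"

lemma spec_val: "P x \<Longrightarrow> spec (val x) c P"
  by (simp add: spec_def)

lemma spec_weaken: "spec m c P \<Longrightarrow> c \<le> c' \<Longrightarrow> (\<And>x. P x \<Longrightarrow> Q x) \<Longrightarrow> spec m c' Q"
  unfolding spec_def by (meson add_left_mono le_trans)

lemma spec_bind:
  assumes m: "spec m c P" and f: "\<And>x. P x \<Longrightarrow> spec (f x) c' Q"
  shows "spec (State_Monad.bind m f) (c + c') Q"
  unfolding spec_def
proof
  fix n
  obtain x n' where run: "run_state m n = (x, n')" by (cases "run_state m n")
  have "P x" "n' \<le> n + c" using m run unfolding spec_def by (metis fst_conv, metis snd_conv)
  moreover have "Q (fst (run_state (f x) n')) \<and> snd (run_state (f x) n') \<le> n' + c'"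
    using f[OF \<open>P x\<close>] unfolding spec_def by blast
  ultimately show "Q (fst (run_state (State_Monad.bind m f) n))
      \<and> snd (run_state (State_Monad.bind m f) n) \<le> n + (c + c')"
    using run by simp
qed

lemma computes_bind:
  "computes m c x \<Longrightarrow> spec (f x) c' Q \<Longrightarrow> spec (State_Monad.bind m f) (c + c') Q"
  by (rule spec_bind[where P = "\<lambda>y. y = x"]) auto

lemma computes_counted2:
  assumes "computes m c x" "computes m' c' y"
  shows "computes (counted2 f m m') (c + (c' + 1)) (f x y)"
  unfolding counted2_def
  by (intro computes_bind[OF assms(1)] computes_bind[OF assms(2)])
     (simp add: spec_def State_Monad.update_def)

lemma computes_val: "computes (val x) 0 x"
  by (rule spec_val) simp

lemma computes_sum:
  assumes "\<And>x. x \<in> set xs \<Longrightarrow> computes (f x) c (g x)"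
  shows "computes (sum_c (map f xs)) (length xs * (c + 1)) (sum_list (map g xs))"
  using assms
proof (induction xs)
  case Nil
  then show ?case by (simp add: computes_val)
next
  case (Cons x xs)
  then have "computes (f x +\<^sub>c sum_c (map f xs)) (c + (length xs * (c + 1) + 1))
      (g x + sum_list (map g xs))"
    by (intro computes_counted2) simp_all
  then show ?case unfolding list.map sum_c.simps by (rule spec_weaken) auto
qed

lemma computes_sum_upt:
  assumes "\<And>i. m \<le> i \<Longrightarrow> i < n \<Longrightarrow> computes (f i) c (g i)"
  shows "computes (sum_c (map f [m..<n])) ((n - m) * (c + 1)) (\<Sum>i=m..<n. g i)"
  using computes_sum[of "[m..<n]" f c g] assms by (simp add: interv_sum_list_conv_sum_set_nat)

lemma computes_sum_val:
  "computes (sum_c (map (\<lambda>j. val (g j)) [m..<n])) (n - m) (\<Sum>i=m..<n. g i)"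
  using computes_sum_upt[of m n "\<lambda>j. val (g j)" 0 g] by (simp add: computes_val)


section \<open>Sorting, selection of the next event, minimisation of a quadratic\<close>

lemma spec_insert_user:
  "spec (insert_user a u vs) (length vs) (\<lambda>ws. mset ws = add_mset u (mset vs) \<and>
    (sorted_wrt (\<lambda>u v. a u \<le> a v) vs \<longrightarrow> sorted_wrt (\<lambda>u v. a u \<le> a v) ws))"
proof (induction vs)
  case Nil
  then show ?case by (simp add: spec_val)
next
  case (Cons v vs)
  let ?P = "\<lambda>ws. mset ws = add_mset u (mset (v # vs)) \<and>
    (sorted_wrt (\<lambda>u v. a u \<le> a v) (v # vs) \<longrightarrow> sorted_wrt (\<lambda>u v. a u \<le> a v) ws)"
  have "spec (if a u \<le> a v then val (u # v # vs)
      else State_Monad.bind (insert_user a u vs) (\<lambda>ws. val (v # ws))) (length vs) ?P"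
  proof (cases "a u \<le> a v")
    case True
    moreover from this have "sorted_wrt (\<lambda>u v. a u \<le> a v) (v # vs) \<Longrightarrow>
        sorted_wrt (\<lambda>u v. a u \<le> a v) (u # v # vs)"
      by (fastforce intro: order_trans)
    ultimately show ?thesis by (auto intro!: spec_val)
  next
    case False
    have "spec (State_Monad.bind (insert_user a u vs) (\<lambda>ws. val (v # ws))) (length vs + 0) ?P"
    proof (intro spec_bind[OF Cons.IH] spec_val, elim conjE)
      fix ws
      assume ws: "mset ws = add_mset u (mset vs)"
        "sorted_wrt (\<lambda>u v. a u \<le> a v) vs \<longrightarrow> sorted_wrt (\<lambda>u v. a u \<le> a v) ws"
      have "set ws = insert u (set vs)" using mset_eq_setD[of ws "u # vs"] ws(1) by simp
      then show "?P (v # ws)" using ws False by auto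
    qed
    then show ?thesis using False by simp
  qed
  then have "spec (State_Monad.bind (val (a u) \<le>\<^sub>c val (a v)) (\<lambda>b. if b then val (u # v # vs)
      else State_Monad.bind (insert_user a u vs) (\<lambda>ws. val (v # ws)))) (0 + (0 + 1) + length vs) ?P"
    by (intro computes_bind[OF computes_counted2[OF computes_val computes_val]])
  then show ?case by simp
qed

lemma spec_sort_users:
  "spec (sort_users a us) (length us * length us)
    (\<lambda>vs. mset vs = mset us \<and> sorted_wrt (\<lambda>u v. a u \<le> a v) vs)"
proof (induction us)
  case Nil
  then show ?case by (simp add: spec_val)
next
  case (Cons u us)
  have "spec (State_Monad.bind (sort_users a us) (\<lambda>vs. insert_user a u vs))
      (length us * length us + length us)
      (\<lambda>vs. mset vs = mset (u # us) \<and> sorted_wrt (\<lambda>u v. a u \<le> a v) vs)"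
  proof (rule spec_bind[OF Cons.IH], elim conjE)
    fix vs assume vs: "mset vs = mset us" "sorted_wrt (\<lambda>u v. a u \<le> a v) vs"
    then have "length vs = length us" by (metis size_mset)
    with spec_insert_user[of a u vs]
    show "spec (insert_user a u vs) (length us)
        (\<lambda>vs. mset vs = mset (u # us) \<and> sorted_wrt (\<lambda>u v. a u \<le> a v) vs)"
      using vs by (auto elim!: spec_weaken)
  qed
  then show ?case by (auto elim!: spec_weaken)
qed

text \<open>Two possible events, each with one comparison, two subtractions and a division.\<close>

lemma computes_departure_events:
  "computes (departure_events N k \<phi> \<zeta> \<theta> \<eta> i) 8 (departure_event_list N k \<phi> \<zeta> \<theta> \<eta> i)"
proof -
  have event: "computes (State_Monad.bind (val p <\<^sub>c val q) (\<lambda>b. if b then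
        State_Monad.bind ((val u -\<^sub>c val v) /\<^sub>c (val w -\<^sub>c val z)) (\<lambda>t. val [(t, e)])
        else val [])) 4 (if p < q then [((u - v) / (w - z), e)] else [])"
    for p q u v w z :: real and e :: event
    by (auto simp: spec_def counted2_def State_Monad.update_def)
  have up: "computes (if k i < N then State_Monad.bind (val (\<phi> (Suc (k i))) <\<^sub>c val (\<theta> i)) (\<lambda>b. if b then
        State_Monad.bind ((val (\<zeta> (Suc (k i))) -\<^sub>c val (\<eta> i)) /\<^sub>c (val (\<theta> i) -\<^sub>c val (\<phi> (Suc (k i)))))
          (\<lambda>t. val [(t, Departure_Up i)]) else val []) else val []) 4
      (if k i < N \<and> \<phi> (Suc (k i)) < \<theta> i
       then [((\<zeta> (Suc (k i)) - \<eta> i) / (\<theta> i - \<phi> (Suc (k i))), Departure_Up i)] else [])"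
    using event by (auto intro: spec_val)
  have down: "computes (if i < k i then State_Monad.bind (val (\<theta> i) <\<^sub>c val (\<phi> (k i))) (\<lambda>b. if b then
        State_Monad.bind ((val (\<zeta> (k i)) -\<^sub>c val (\<eta> i)) /\<^sub>c (val (\<theta> i) -\<^sub>c val (\<phi> (k i))))
          (\<lambda>t. val [(t, Departure_Down i)]) else val []) else val []) 4
      (if i < k i \<and> \<theta> i < \<phi> (k i)
       then [((\<zeta> (k i) - \<eta> i) / (\<theta> i - \<phi> (k i)), Departure_Down i)] else [])"
    using event by (auto intro: spec_val)
  have "spec (departure_events N k \<phi> \<zeta> \<theta> \<eta> i) (4 + (4 + 0))
      (\<lambda>x. x = departure_event_list N k \<phi> \<zeta> \<theta> \<eta> i)"
    unfolding departure_events_def departure_event_list_def Let_def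
    by (intro computes_bind[OF up] computes_bind[OF down] computes_val)
  then show ?thesis by simp
qed

lemma computes_all_departure_events:
  "computes (all_departure_events N k \<phi> \<zeta> \<theta> \<eta> is) (8 * length is)
    (concat (map (departure_event_list N k \<phi> \<zeta> \<theta> \<eta>) is))"
proof (induction "is")
  case Nil
  then show ?case by (simp add: computes_val)
next
  case (Cons i "is")
  have "computes (all_departure_events N k \<phi> \<zeta> \<theta> \<eta> (i # is)) (8 + (8 * length is + 0))
      (concat (map (departure_event_list N k \<phi> \<zeta> \<theta> \<eta>) (i # is)))"
    unfolding all_departure_events.simps concat.simps list.map
    by (intro computes_bind[OF computes_departure_events] computes_bind[OF Cons.IH] computes_val)
  then show ?case by simp
qed

text \<open>The precedence at equal times. Both events of a departure share a rank: the analysis of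
  an event needs only those of smaller rank to be strictly later.\<close>

fun event_rank :: "event \<Rightarrow> nat" where
  "event_rank Stop = 0"
| "event_rank Arrival_Swap = 1"
| "event_rank (Departure_Up i) = Suc i"
| "event_rank (Departure_Down i) = Suc i"

definition not_after :: "real \<times> event \<Rightarrow> real \<times> event \<Rightarrow> bool" where
  "not_after e f \<longleftrightarrow> fst e < fst f \<or> fst e = fst f \<and> event_rank (snd e) \<le> event_rank (snd f)"

lemma not_after_trans: "not_after e f \<Longrightarrow> not_after f g \<Longrightarrow> not_after e g"
  unfolding not_after_def by auto

text \<open>The comparison of times is strict, so a tie keeps the entry that stands first. On a list
  sorted by rank this is tie-breaking by rank.\<close>

lemma spec_earliest:
  assumes "sorted (map (event_rank \<circ> snd) (e # fs))"
  shows "spec (earliest e fs) (length fs) (\<lambda>g. g \<in> set (e # fs) \<and> (\<forall>f\<in>set (e # fs). not_after g f))"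
  using assms
proof (induction fs arbitrary: e)
  case Nil
  then show ?case by (simp add: spec_val not_after_def)
next
  case (Cons f fs)
  let ?e = "if fst f < fst e then f else e"
  have "spec (earliest ?e fs) (length fs) (\<lambda>g. g \<in> set (?e # fs) \<and> (\<forall>f\<in>set (?e # fs). not_after g f))"
    using Cons.prems by (intro Cons.IH) auto
  then have "spec (earliest ?e fs) (length fs)
      (\<lambda>g. g \<in> set (e # f # fs) \<and> (\<forall>f\<in>set (e # f # fs). not_after g f))"
  proof (rule spec_weaken)
    fix g assume g: "g \<in> set (?e # fs) \<and> (\<forall>f\<in>set (?e # fs). not_after g f)"
    have "not_after ?e e" "not_after ?e f" using Cons.prems by (auto simp: not_after_def)
    moreover have "not_after g ?e" using g by simp
    ultimately have "not_after g e" "not_after g f" by (blast intro: not_after_trans)+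
    then show "g \<in> set (e # f # fs) \<and> (\<forall>f\<in>set (e # f # fs). not_after g f)"
      using g by (auto split: if_splits)
  qed simp
  then have "spec (earliest e (f # fs)) (0 + (0 + 1) + length fs)
      (\<lambda>g. g \<in> set (e # f # fs) \<and> (\<forall>f\<in>set (e # f # fs). not_after g f))"
    unfolding earliest.simps by (intro computes_bind[OF computes_counted2[OF computes_val computes_val]])
  then show ?case by simp
qed

lemma departure_event_list_rank:
  "(t, e) \<in> set (departure_event_list N k \<phi> \<zeta> \<theta> \<eta> i) \<Longrightarrow> event_rank e = Suc i"
  by (auto simp: departure_event_list_def split: if_splits)

lemma length_departure_event_list: "length (departure_event_list N k \<phi> \<zeta> \<theta> \<eta> i) \<le> 2"
  by (simp add: departure_event_list_def)

definition candidates ::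
  "nat \<Rightarrow> real \<Rightarrow> nat \<Rightarrow> (nat \<Rightarrow> nat) \<Rightarrow> (nat \<Rightarrow> real) \<Rightarrow> (nat \<Rightarrow> real) \<Rightarrow> (nat \<Rightarrow> real) \<Rightarrow> (nat \<Rightarrow> real)
    \<Rightarrow> (real \<times> event) set" where
  "candidates N ub p k \<phi> \<zeta> \<theta> \<eta> = {(ub, Stop)} \<union> {e. p < N \<and> e = (\<zeta> (Suc p), Arrival_Swap)} \<union>
    (\<Union>i\<in>{1..N}. set (departure_event_list N k \<phi> \<zeta> \<theta> \<eta> i))"

lemma spec_next_breakpoint:
  "spec (next_breakpoint N ub p k \<phi> \<zeta> \<theta> \<eta>) (10 * N + 1)
    (\<lambda>e. e \<in> candidates N ub p k \<phi> \<zeta> \<theta> \<eta> \<and> (\<forall>f\<in>candidates N ub p k \<phi> \<zeta> \<theta> \<eta>. not_after e f))"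
proof -
  let ?swap = "if p < N then [(\<zeta> (Suc p), Arrival_Swap)] else []"
  have ranks: "sorted (map (event_rank \<circ> snd) es)
      \<and> (\<forall>e\<in>set es. 2 \<le> event_rank (snd e) \<and> event_rank (snd e) \<le> Suc n) \<and> length es \<le> 2 * n"
    if "es = concat (map (departure_event_list N k \<phi> \<zeta> \<theta> \<eta>) [1..<Suc n])" for es n
    using that
  proof (induction n arbitrary: es)
    case 0
    then show ?case by simp
  next
    case (Suc n)
    let ?new = "departure_event_list N k \<phi> \<zeta> \<theta> \<eta> (Suc n)"
    define old where "old = concat (map (departure_event_list N k \<phi> \<zeta> \<theta> \<eta>) [1..<Suc n])"
    have es: "es = old @ ?new" using Suc.prems by (simp add: old_def)
    have new: "event_rank (snd e) = Suc (Suc n)" if "e \<in> set ?new" for e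
      using departure_event_list_rank[of "fst e" "snd e"] that by simp
    then have "map (event_rank \<circ> snd) ?new = replicate (length ?new) (Suc (Suc n))"
      by (intro replicate_eqI) auto
    then have "sorted (map (event_rank \<circ> snd) ?new)" by simp
    moreover have old: "sorted (map (event_rank \<circ> snd) old)" "length old \<le> 2 * n"
      "\<And>e. e \<in> set old \<Longrightarrow> 2 \<le> event_rank (snd e) \<and> event_rank (snd e) \<le> Suc n"
      using Suc.IH[OF old_def] by blast+
    moreover have "2 \<le> event_rank (snd e) \<and> event_rank (snd e) \<le> Suc (Suc n)"
      if "e \<in> set old \<union> set ?new" for e
      using that new[of e] old(3)[of e] by auto
    ultimately show ?case
      unfolding es using new length_departure_event_list[of N k \<phi> \<zeta> \<theta> \<eta> "Suc n"]
      by (simp add: sorted_append le_SucI comp_def)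
  qed
  define es where "es = concat (map (departure_event_list N k \<phi> \<zeta> \<theta> \<eta>) [1..<Suc N])"
  note es = ranks[OF es_def]
  have set: "candidates N ub p k \<phi> \<zeta> \<theta> \<eta> = set ((ub, Stop) # ?swap @ es)"
    unfolding candidates_def es_def by (auto simp: less_Suc_eq_le)
  have "\<forall>e\<in>set es. Suc 0 \<le> event_rank (snd e)" using es by fastforce
  then have "sorted (map (event_rank \<circ> snd) ((ub, Stop) # ?swap @ es))"
    using es by (simp add: sorted_append)
  from spec_earliest[OF this]
  have "spec (earliest (ub, Stop) (?swap @ es)) (2 * N + 1)
      (\<lambda>e. e \<in> candidates N ub p k \<phi> \<zeta> \<theta> \<eta> \<and> (\<forall>f\<in>candidates N ub p k \<phi> \<zeta> \<theta> \<eta>. not_after e f))"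
    unfolding set using es by (elim spec_weaken) simp_all
  \<comment> \<open>Computing the events costs 8 per departure; then at most 2 N of them and one
    swap are compared.\<close>
  then have "spec (next_breakpoint N ub p k \<phi> \<zeta> \<theta> \<eta>) (8 * length [1..<Suc N] + (2 * N + 1))
      (\<lambda>e. e \<in> candidates N ub p k \<phi> \<zeta> \<theta> \<eta> \<and> (\<forall>f\<in>candidates N ub p k \<phi> \<zeta> \<theta> \<eta>. not_after e f))"
    unfolding next_breakpoint_def es_def by (intro computes_bind[OF computes_all_departure_events])
  then show ?thesis by (rule spec_weaken) simp_all
qed

lemma quadratic_vertex:
  fixes A B C y v :: real
  assumes "0 < A" "v = - B / (2 * A)"
  shows "(A * y + B) * y + C = A * (y - v)\<^sup>2 + ((A * v + B) * v + C)"
proof -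
  have "B = - 2 * A * v" using assms by simp
  then show ?thesis by (simp add: power2_eq_square algebra_simps)
qed

lemma spec_minimize_quadratic:
  assumes "0 \<le> A" "l \<le> u"
  shows "spec (minimize_quadratic A B C l u) 10 (\<lambda>(x, c). x \<in> {l..u} \<and> c = (A * x + B) * x + C \<and>
    (\<forall>y\<in>{l..u}. c \<le> (A * y + B) * y + C))"
proof -
  define x where "x = (if 0 < A then (let v = (0 - B) / (2 * A) in if v < l then l else if u < v then u else v)
    else if 0 \<le> B then l else u)"
  have "computes (minimize_quadratic A B C l u) 10 (x, (A * x + B) * x + C)"
    by (auto simp: minimize_quadratic_def spec_def counted2_def State_Monad.update_def x_def Let_def)
  then show ?thesis
  proof (rule spec_weaken)
    have x: "x \<in> {l..u}" using assms by (auto simp: x_def Let_def)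
    have min: "(A * x + B) * x + C \<le> (A * y + B) * y + C" if y: "y \<in> {l..u}" for y
    proof (cases "0 < A")
      case True
      define v where "v = - B / (2 * A)"
      have "x = (if v < l then l else if u < v then u else v)"
        using True by (simp add: x_def v_def Let_def)
      \<comment> \<open>The clamped vertex is the point of the interval nearest to the
        vertex.\<close>
      then have "\<bar>x - v\<bar> \<le> \<bar>y - v\<bar>" using y by (simp split: if_split)
      then have "A * (x - v)\<^sup>2 \<le> A * (y - v)\<^sup>2"
        using True by (simp add: abs_le_square_iff)
      then show ?thesis using quadratic_vertex[OF True v_def, of x C] quadratic_vertex[OF True v_def, of y C]
        by linarith
    next
      case False
      then have "A = 0" using assms by simp
      then show ?thesis using y by (auto simp: x_def mult_left_mono mult_left_mono_neg)
    qed
    show "case z of (x, c) \<Rightarrow> x \<in> {l..u} \<and> c = (A * x + B) * x + C \<and>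
        (\<forall>y\<in>{l..u}. c \<le> (A * y + B) * y + C)" if "z = (x, (A * x + B) * x + C)" for z
      using x min that by simp
  qed simp
qed

lemma computes_cost_coefficients:
  "computes (cost_coefficients N \<gamma> d_opt \<sigma> \<phi> \<zeta> \<theta> \<eta>) (16 * N)
    (\<Sum>i=1..N. \<theta> i * \<theta> i,
     \<Sum>i=1..N. 2 * \<theta> i * (\<eta> i - d_opt (\<sigma> i)) + \<gamma> * (\<theta> i - \<phi> i),
     \<Sum>i=1..N. (\<eta> i - d_opt (\<sigma> i)) * (\<eta> i - d_opt (\<sigma> i)) + \<gamma> * (\<eta> i - \<zeta> i))"
proof -
  have up: "{1..N} = {1..<Suc N}" by auto
  note simps = spec_def counted2_def State_Monad.update_def
  have A: "computes (sum_c (map (\<lambda>i. val (\<theta> i) *\<^sub>c val (\<theta> i)) [1..<Suc N])) ((Suc N - 1) * (1 + 1))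
      (\<Sum>i=1..<Suc N. \<theta> i * \<theta> i)"
    by (rule computes_sum_upt) (simp add: simps)
  have B: "computes (sum_c (map (\<lambda>i.
          val 2 *\<^sub>c val (\<theta> i) *\<^sub>c (val (\<eta> i) -\<^sub>c val (d_opt (\<sigma> i)))
          +\<^sub>c val \<gamma> *\<^sub>c (val (\<theta> i) -\<^sub>c val (\<phi> i))) [1..<Suc N])) ((Suc N - 1) * (6 + 1))
      (\<Sum>i=1..<Suc N. 2 * \<theta> i * (\<eta> i - d_opt (\<sigma> i)) + \<gamma> * (\<theta> i - \<phi> i))"
    by (rule computes_sum_upt) (simp add: simps)
  have C: "computes (sum_c (map (\<lambda>i.
          (val (\<eta> i) -\<^sub>c val (d_opt (\<sigma> i))) *\<^sub>c (val (\<eta> i) -\<^sub>c val (d_opt (\<sigma> i)))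
          +\<^sub>c val \<gamma> *\<^sub>c (val (\<eta> i) -\<^sub>c val (\<zeta> i))) [1..<Suc N])) ((Suc N - 1) * (6 + 1))
      (\<Sum>i=1..<Suc N. (\<eta> i - d_opt (\<sigma> i)) * (\<eta> i - d_opt (\<sigma> i)) + \<gamma> * (\<eta> i - \<zeta> i))"
    by (rule computes_sum_upt) (simp add: simps)
  have "computes (cost_coefficients N \<gamma> d_opt \<sigma> \<phi> \<zeta> \<theta> \<eta>)
      ((Suc N - 1) * (1 + 1) + ((Suc N - 1) * (6 + 1) + ((Suc N - 1) * (6 + 1) + 0)))
    (\<Sum>i=1..N. \<theta> i * \<theta> i,
     \<Sum>i=1..N. 2 * \<theta> i * (\<eta> i - d_opt (\<sigma> i)) + \<gamma> * (\<theta> i - \<phi> i),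
     \<Sum>i=1..N. (\<eta> i - d_opt (\<sigma> i)) * (\<eta> i - d_opt (\<sigma> i)) + \<gamma> * (\<eta> i - \<zeta> i))"
    unfolding cost_coefficients_def up
    by (intro computes_bind[OF A] computes_bind[OF B] computes_bind[OF C] computes_val)
  then show ?thesis by (rule spec_weaken) simp_all
qed


section \<open>Correctness of the recursions\<close>

context slowdown_system
begin

lemma star_cong:
  assumes "1 \<le> i" "\<forall>j\<in>{1..i}. d j = e j"
  shows "star k b d i = star k b e i"
proof -
  have "(\<Sum>j=hvec k i..<i. d j) = (\<Sum>j=hvec k i..<i. e j)"
    using hvec_props[OF assms(1), where k = k] assms(2) by (intro sum.cong) auto
  then show ?thesis using assms unfolding star_def by simp
qed

text \<open>With affine arrivals and earlier departures, \<open>star\<close> is an identity in x;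
  \<open>t\<close> and \<open>e\<close> are its slope and constant term divided by the positive left
  factor. Each takes two sums of at most N terms and about ten further operations.\<close>

lemma spec_coefficients:
  assumes k: "\<forall>i\<in>{1..N}. i \<le> k i \<and> k i \<le> N" and n: "n \<le> N"
  shows "spec (coefficients \<alpha> \<beta> k \<phi> \<zeta> n) (n * (4 * N + 19)) (\<lambda>(\<theta>, \<eta>). \<forall>i\<in>{1..n}. \<forall>x.
    star k (\<lambda>i. \<phi> i * x + \<zeta> i) (\<lambda>i. \<theta> i * x + \<eta> i) i)"
  using n
proof (induction n)
  case 0
  then show ?case by (simp add: spec_val)
next
  case (Suc n)
  let ?i = "Suc n" and ?c = "4 * N + 19"
  let ?h = "hvec k ?i"
  let ?P = "\<lambda>n (\<theta>, \<eta>). \<forall>i\<in>{1..n}. \<forall>x. star k (\<lambda>i. \<phi> i * x + \<zeta> i) (\<lambda>i. \<theta> i * x + \<eta> i) i"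
  have ki: "?i \<le> k ?i" "k ?i \<le> N" using k Suc.prems by auto
  have den: "\<beta> - \<alpha> * real (k ?i - ?i) \<noteq> 0" using gap_line_pos[of ?i "k ?i"] ki by simp
  have IH: "spec (coefficients \<alpha> \<beta> k \<phi> \<zeta> n) (n * ?c) (?P n)"
    using Suc by simp
  have "spec (coefficients \<alpha> \<beta> k \<phi> \<zeta> (Suc n)) (n * ?c + ?c) (?P (Suc n))"
    unfolding coefficients.simps Let_def
  proof (rule spec_bind[OF IH], clarify)
    fix \<theta> \<eta> :: "nat \<Rightarrow> real"
    assume star: "\<forall>i\<in>{1..n}. \<forall>x. star k (\<lambda>i. \<phi> i * x + \<zeta> i) (\<lambda>i. \<theta> i * x + \<eta> i) i"
    define t where "t = ((\<beta> - \<alpha> * real (?i - ?h)) * \<phi> ?i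
        + \<alpha> * ((\<Sum>j=?h..<?i. \<theta> j) - (\<Sum>j=Suc ?i..<Suc (k ?i). \<phi> j))) / (\<beta> - \<alpha> * real (k ?i - ?i))"
    define e where "e = (1 + (\<beta> - \<alpha> * real (?i - ?h)) * \<zeta> ?i
        + \<alpha> * ((\<Sum>j=?h..<?i. \<eta> j) - (\<Sum>j=Suc ?i..<Suc (k ?i). \<zeta> j))) / (\<beta> - \<alpha> * real (k ?i - ?i))"
    have post: "?P (Suc n) (\<theta>(?i := t), \<eta>(?i := e))"
    proof (clarify)
      fix i x assume i: "i \<in> {1..Suc n}"
      show "star k (\<lambda>i. \<phi> i * x + \<zeta> i) (\<lambda>i. (\<theta>(?i := t)) i * x + (\<eta>(?i := e)) i) i"
      proof (cases "i \<le> n")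
        case True
        then show ?thesis
          using star i star_cong[of i "\<lambda>i. (\<theta>(?i := t)) i * x + (\<eta>(?i := e)) i" "\<lambda>i. \<theta> i * x + \<eta> i"]
          by simp
      next
        case False
        then have i: "i = ?i" using i by simp
        have d: "(\<Sum>j=?h..<?i. (\<theta>(?i := t)) j * x + (\<eta>(?i := e)) j)
            = (\<Sum>j=?h..<?i. \<theta> j) * x + (\<Sum>j=?h..<?i. \<eta> j)"
        proof -
          have "(\<Sum>j=?h..<?i. (\<theta>(?i := t)) j * x + (\<eta>(?i := e)) j) = (\<Sum>j=?h..<?i. \<theta> j * x + \<eta> j)"
            by (intro sum.cong) auto
          then show ?thesis by (simp only: sum.distrib sum_distrib_right)
        qed
        have b: "(\<Sum>j=Suc ?i..k ?i. \<phi> j * x + \<zeta> j)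
            = (\<Sum>j=Suc ?i..<Suc (k ?i). \<phi> j) * x + (\<Sum>j=Suc ?i..<Suc (k ?i). \<zeta> j)"
          by (simp add: sum.distrib sum_distrib_right atLeastLessThanSuc_atLeastAtMost)
        have t: "t * (\<beta> - \<alpha> * real (k ?i - ?i)) = (\<beta> - \<alpha> * real (?i - ?h)) * \<phi> ?i
            + \<alpha> * ((\<Sum>j=?h..<?i. \<theta> j) - (\<Sum>j=Suc ?i..<Suc (k ?i). \<phi> j))"
          using den unfolding t_def by simp
        have e: "e * (\<beta> - \<alpha> * real (k ?i - ?i)) = 1 + (\<beta> - \<alpha> * real (?i - ?h)) * \<zeta> ?i
            + \<alpha> * ((\<Sum>j=?h..<?i. \<eta> j) - (\<Sum>j=Suc ?i..<Suc (k ?i). \<zeta> j))"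
          using den unfolding e_def by simp
        have "(\<beta> - \<alpha> * real (k ?i - ?i)) * (t * x + e)
            = (t * (\<beta> - \<alpha> * real (k ?i - ?i))) * x + e * (\<beta> - \<alpha> * real (k ?i - ?i))"
          by (simp only: algebra_simps)
        also have "\<dots>
            = ((\<beta> - \<alpha> * real (?i - ?h)) * \<phi> ?i
              + \<alpha> * ((\<Sum>j=?h..<?i. \<theta> j) - (\<Sum>j=Suc ?i..<Suc (k ?i). \<phi> j))) * x
              + (1 + (\<beta> - \<alpha> * real (?i - ?h)) * \<zeta> ?i
              + \<alpha> * ((\<Sum>j=?h..<?i. \<eta> j) - (\<Sum>j=Suc ?i..<Suc (k ?i). \<zeta> j)))"
          by (simp only: t e)
        also have "\<dots> = 1 + (\<beta> - \<alpha> * real (?i - ?h)) * (\<phi> ?i * x + \<zeta> ?i)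
            + \<alpha> * (((\<Sum>j=?h..<?i. \<theta> j) * x + (\<Sum>j=?h..<?i. \<eta> j))
            - ((\<Sum>j=Suc ?i..<Suc (k ?i). \<phi> j) * x + (\<Sum>j=Suc ?i..<Suc (k ?i). \<zeta> j)))"
          by (simp only: algebra_simps)
        finally show ?thesis unfolding star_def i d b by simp
      qed
    qed
    let ?t = "((val \<beta> -\<^sub>c val \<alpha> *\<^sub>c val (real (?i - ?h))) *\<^sub>c val (\<phi> ?i)
        +\<^sub>c val \<alpha> *\<^sub>c (sum_c (map (\<lambda>j. val (\<theta> j)) [?h..<?i])
                     -\<^sub>c sum_c (map (\<lambda>j. val (\<phi> j)) [Suc ?i..<Suc (k ?i)])))
        /\<^sub>c (val \<beta> -\<^sub>c val \<alpha> *\<^sub>c val (real (k ?i - ?i)))"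
    let ?e = "(val 1 +\<^sub>c (val \<beta> -\<^sub>c val \<alpha> *\<^sub>c val (real (?i - ?h))) *\<^sub>c val (\<zeta> ?i)
        +\<^sub>c val \<alpha> *\<^sub>c (sum_c (map (\<lambda>j. val (\<eta> j)) [?h..<?i])
                     -\<^sub>c sum_c (map (\<lambda>j. val (\<zeta> j)) [Suc ?i..<Suc (k ?i)])))
        /\<^sub>c (val \<beta> -\<^sub>c val \<alpha> *\<^sub>c val (real (k ?i - ?i)))"
    have t: "computes ?t (9 + 2 * N) t"
      unfolding t_def
      apply (rule spec_weaken, (rule computes_counted2 computes_val computes_sum_val)+)
      using Suc.prems ki by simp_all
    have e: "computes ?e (10 + 2 * N) e"
      unfolding e_def
      apply (rule spec_weaken, (rule computes_counted2 computes_val computes_sum_val)+)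
      using Suc.prems ki by simp_all
    have "spec (State_Monad.bind ?t (\<lambda>t. State_Monad.bind ?e (\<lambda>e. val (\<theta>(?i := t), \<eta>(?i := e)))))
        (9 + 2 * N + (10 + 2 * N + 0)) (?P (Suc n))"
      by (rule computes_bind[OF t], rule computes_bind[OF e], rule spec_val, rule post)
    then show "spec (State_Monad.bind ?t (\<lambda>t. State_Monad.bind ?e
        (\<lambda>e. val (\<theta>(?i := t), \<eta>(?i := e))))) ?c (?P (Suc n))"
      by (rule spec_weaken) simp_all
  qed
  then show ?case by (simp add: algebra_simps)
qed

text \<open>\<open>s / c\<close> is always the point where \<open>gap_line m b i\<close> takes the
  value \<open>L\<close>, and the loop keeps it at or after \<open>b m\<close>. The search stops on
  the first linear piece that contains its own solution.\<close>

lemma spec_solve_departure: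
  assumes b: "mono_on {1..N} b" and i: "1 \<le> i" and m: "i \<le> m" "m \<le> N"
    and c: "c = \<beta> - \<alpha> * real (m - i)" and s: "s = L + \<beta> * b i - \<alpha> * (\<Sum>j=Suc i..m. b j)"
    and bm: "b m \<le> s / c"
  shows "spec (solve_departure \<alpha> b m [Suc m..<Suc N] s c) (5 * (N - m) + 1) (\<lambda>(d, k).
    i \<le> k \<and> k \<le> N \<and> b k \<le> d \<and> (k < N \<longrightarrow> d \<le> b (Suc k)) \<and> gap_line k b i d = L)"
  using m c s bm
proof (induction "N - m" arbitrary: m s c)
  case (0 m s c)
  then have m: "m = N" by simp
  have "0 < c" using gap_line_pos[of i m] i 0 by simp
  then have line: "gap_line m b i (s / c) = L"
    unfolding gap_line_def 0(4)[symmetric] by (simp add: 0(5))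
  have "spec (solve_departure \<alpha> b m [] s c) (0 + (0 + 1) + 0) (\<lambda>(d, k).
      i \<le> k \<and> k \<le> N \<and> b k \<le> d \<and> (k < N \<longrightarrow> d \<le> b (Suc k)) \<and> gap_line k b i d = L)"
    unfolding solve_departure.simps using 0 m line
    by (intro computes_bind[OF computes_counted2[OF computes_val computes_val]] spec_val) simp
  then show ?case using m by simp
next
  case (Suc r m s c)
  let ?P = "\<lambda>(d, k). i \<le> k \<and> k \<le> N \<and> b k \<le> d \<and> (k < N \<longrightarrow> d \<le> b (Suc k)) \<and> gap_line k b i d = L"
  have m: "m < N" using Suc.hyps(2) by simp
  have c: "0 < c" using gap_line_pos[of i m] i Suc.prems by simp
  then have line: "gap_line m b i (s / c) = L"
    unfolding gap_line_def Suc.prems(3)[symmetric] by (simp add: Suc.prems(4))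
  let ?s = "s - \<alpha> * b (Suc m)" and ?c = "c - \<alpha>"
  have next_c: "?c = \<beta> - \<alpha> * real (Suc m - i)"
    using Suc.prems by (simp add: Suc_diff_le algebra_simps)
  have next_s: "?s = L + \<beta> * b i - \<alpha> * (\<Sum>j=Suc i..Suc m. b j)"
    using Suc.prems by (simp add: algebra_simps)
  have c': "0 < ?c" using gap_line_pos[of i "Suc m"] i m unfolding next_c by simp
  have "spec (if s / c < b (Suc m) then val (s / c, m) else
      State_Monad.bind (val s -\<^sub>c val \<alpha> *\<^sub>c val (b (Suc m))) (\<lambda>s'.
        State_Monad.bind (val c -\<^sub>c val \<alpha>) (\<lambda>c'. solve_departure \<alpha> b (Suc m) [Suc (Suc m)..<Suc N] s' c')))
      (0 + (0 + (0 + 1) + 1) + ((0 + (0 + 1)) + (5 * (N - Suc m) + 1))) ?P"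
  proof (cases "s / c < b (Suc m)")
    case True
    then show ?thesis using Suc.prems line m by (auto intro!: spec_val)
  next
    case False
    \<comment> \<open>Subtracting \<alpha> \<open>b (Suc m)\<close> on both sides gives the same
      inequality for the next candidate.\<close>
    then have "c * b (Suc m) \<le> s" using c by (simp add: field_simps)
    then have "b (Suc m) \<le> ?s / ?c" using c' by (simp add: field_simps)
    then have "spec (solve_departure \<alpha> b (Suc m) [Suc (Suc m)..<Suc N] ?s ?c) (5 * (N - Suc m) + 1) ?P"
      using Suc.prems(1) Suc.hyps(2) m next_c next_s by (intro Suc.hyps(1)) simp_all
    then have "spec (State_Monad.bind (val s -\<^sub>c val \<alpha> *\<^sub>c val (b (Suc m))) (\<lambda>s'.
        State_Monad.bind (val c -\<^sub>c val \<alpha>) (\<lambda>c'. solve_departure \<alpha> b (Suc m) [Suc (Suc m)..<Suc N] s' c')))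
      (0 + (0 + (0 + 1) + 1) + ((0 + (0 + 1)) + (5 * (N - Suc m) + 1))) ?P"
      by (intro computes_bind[OF computes_counted2[OF computes_val computes_counted2[OF computes_val computes_val]]]
          computes_bind[OF computes_counted2[OF computes_val computes_val]])
    then show ?thesis using False by simp
  qed
  then have "spec (solve_departure \<alpha> b m (Suc m # [Suc (Suc m)..<Suc N]) s c)
      ((0 + (0 + 1)) + ((0 + (0 + 1)) +
      (0 + (0 + (0 + 1) + 1) + ((0 + (0 + 1)) + (5 * (N - Suc m) + 1))))) ?P"
    unfolding solve_departure.simps
    by (intro computes_bind[OF computes_counted2[OF computes_val computes_val]])
  moreover have "[Suc m..<Suc N] = Suc m # [Suc (Suc m)..<Suc N]" using m by (simp add: upt_conv_Cons)
  ultimately have "spec (solve_departure \<alpha> b m [Suc m..<Suc N] s c)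
      ((0 + (0 + 1)) + ((0 + (0 + 1)) +
      (0 + (0 + (0 + 1) + 1) + ((0 + (0 + 1)) + (5 * (N - Suc m) + 1))))) ?P"
    by (simp only:)
  then show ?case by (rule spec_weaken) (use m in auto)
qed

lemma spec_initial_departures:
  assumes b: "mono_on {1..N} b" and n: "n \<le> N"
  shows "spec (initial_departures N \<alpha> \<beta> b n) (n * (6 * N + 10))
    (\<lambda>(d, k). \<forall>i\<in>{1..n}. balanced b d i \<and> compat k b d i)"
  using n
proof (induction n)
  case 0
  then show ?case by (simp add: spec_val)
next
  case (Suc n)
  let ?i = "Suc n" and ?c = "6 * N + 10"
  let ?P = "\<lambda>n (d, k). \<forall>i\<in>{1..n}. balanced b d i \<and> compat k b d i"
  have IH: "spec (initial_departures N \<alpha> \<beta> b n) (n * ?c) (?P n)"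
    using Suc by simp
  have "spec (initial_departures N \<alpha> \<beta> b (Suc n)) (n * ?c + ?c) (?P (Suc n))"
    unfolding initial_departures.simps Let_def
  proof (rule spec_bind[OF IH], clarify)
    fix d :: "nat \<Rightarrow> real" and k :: "nat \<Rightarrow> nat"
    let ?h = "hvec k ?i"
    assume prefix: "\<forall>i\<in>{1..n}. balanced b d i \<and> compat k b d i"
    define s where "s = 1 + (\<beta> - \<alpha> * real (?i - ?h)) * b ?i + \<alpha> * (\<Sum>j=?h..<?i. d j)"
    define L where "L = load b d ?i"
    have "mono_on {1..n} d" using Suc.prems prefix by (intro balanced_mono[OF b]) auto
    then have "L = 1 + \<alpha> * ((\<Sum>j=?h..<?i. d j) - real (?i - ?h) * b ?i)"
      unfolding L_def using Suc.prems prefix by (intro load_eq[OF b]) auto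
    then have s_eq: "s = L + \<beta> * b ?i" unfolding s_def by (simp add: algebra_simps)
    have "0 < \<beta>" using rate_pos'[of 0] N_pos by simp
    then have "b ?i \<le> s / \<beta>"
      using load_ge_1[of b d ?i] unfolding s_eq L_def by (simp add: field_simps)
    then have solve: "spec (solve_departure \<alpha> b ?i [Suc ?i..<Suc N] s \<beta>) (5 * (N - ?i) + 1) (\<lambda>(t, m).
        ?i \<le> m \<and> m \<le> N \<and> b m \<le> t \<and> (m < N \<longrightarrow> t \<le> b (Suc m)) \<and> gap_line m b ?i t = L)"
      using Suc.prems s_eq by (intro spec_solve_departure[OF b]) simp_all
    let ?s = "val 1 +\<^sub>c (val \<beta> -\<^sub>c val \<alpha> *\<^sub>c val (real (?i - ?h))) *\<^sub>c val (b ?i)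
              +\<^sub>c val \<alpha> *\<^sub>c sum_c (map (\<lambda>j. val (d j)) [?h..<?i])"
    have s: "computes ?s (6 + N) s"
      unfolding s_def
      apply (rule spec_weaken, (rule computes_counted2 computes_val computes_sum_val)+)
      using Suc.prems by simp_all
    have post: "?P (Suc n) (d(?i := t), k(?i := m))"
      if t: "?i \<le> m \<and> m \<le> N \<and> b m \<le> t \<and> (m < N \<longrightarrow> t \<le> b (Suc m)) \<and> gap_line m b ?i t = L" for t m
    proof -
      have l: "load b (d(?i := t)) i = load b d i" if "i \<le> ?i" for i
        using that unfolding load_def by (auto intro!: sum.cong)
      have "b ?i \<le> t" using t Suc.prems mono_on_intervalD[OF b, of ?i m] by auto
      moreover have "gap b ?i t = L" using t gap_eq_line[OF b, of ?i m t] by auto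
      ultimately show ?thesis
        using prefix t unfolding balanced_def compat_def
        by (auto simp: l le_Suc_eq L_def)
    qed
    have "spec (State_Monad.bind ?s (\<lambda>s. State_Monad.bind (solve_departure \<alpha> b ?i [Suc ?i..<Suc N] s \<beta>) (\<lambda>(di, ki).
          val (d(?i := di), k(?i := ki))))) (6 + N + (5 * (N - ?i) + 1 + 0)) (?P (Suc n))"
    proof (rule computes_bind[OF s], rule spec_bind[OF solve], clarify)
      fix t m assume "?i \<le> m" "m \<le> N" "b m \<le> t" "m < N \<longrightarrow> t \<le> b (Suc m)" "L = gap_line m b ?i t"
      then show "spec (val (d(?i := t), k(?i := m))) 0 (?P (Suc n))"
        using post[of m t] by (intro spec_val) simp
    qed
    then show "spec (State_Monad.bind ?s (\<lambda>s. State_Monad.bind (solve_departure \<alpha> b ?i [Suc ?i..<Suc N] s \<beta>) (\<lambda>(di, ki).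
          val (d(?i := di), k(?i := ki))))) ?c (?P (Suc n))"
      by (rule spec_weaken) auto
  qed
  then show ?case by (simp add: algebra_simps)
qed

end


section \<open>The number of events\<close>

lemma (in slowdown_system) compat_cong:
  assumes "1 \<le> i" "\<forall>j\<in>{1..N}. b j = b' j" "d i = d' i"
  shows "compat k b d i \<longleftrightarrow> compat k b' d' i"
  using assms unfolding compat_def by auto

lemma (in slowdown_system) balanced_cong:
  assumes "i \<in> {1..N}" "\<forall>j\<in>{1..N}. b j = b' j"
  shows "balanced b d i \<longleftrightarrow> balanced b' d i"
proof -
  have "gap b i t = gap b' i t" for t unfolding gap_def using assms by (auto intro!: sum.cong)
  moreover have "load b d i = load b' d i" unfolding load_def using assms by auto
  ultimately show ?thesis using assms unfolding balanced_def by auto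
qed

lemma mono_on_cong: "(\<And>x. x \<in> S \<Longrightarrow> f x = g x) \<Longrightarrow> mono_on S f \<longleftrightarrow> mono_on S g"
  unfolding monotone_on_def by auto

lemma sum_quadratic:
  fixes x :: real
  shows "(\<Sum>i\<in>I. (f i * x + g i) * x + h i) = ((\<Sum>i\<in>I. f i) * x + (\<Sum>i\<in>I. g i)) * x + (\<Sum>i\<in>I. h i)"
  by (simp add: sum.distrib sum_distrib_right distrib_right)

section \<open>The order of arrivals and the potential while the moving arrival time grows\<close>

locale coordinate_search = slowdown_system +
  fixes \<gamma> :: real and d_opt :: "nat \<Rightarrow> real" and r :: nat and a :: "nat \<Rightarrow> real" and lb ub :: real
  assumes r: "r \<in> {1..N}" and lb_le_ub: "lb \<le> ub"
begin

text \<open>\<open>slope\<close> and \<open>intercept\<close> are the very terms of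
  \<open>search_step\<close>, so that the program can be folded.\<close>

definition slope :: "nat \<Rightarrow> nat \<Rightarrow> real" where
  "slope p = (\<lambda>i. if i = p then 1 else 0)"

definition intercept :: "(nat \<Rightarrow> nat) \<Rightarrow> nat \<Rightarrow> nat \<Rightarrow> real" where
  "intercept \<sigma> p = (\<lambda>i. if i = p then 0 else a (\<sigma> i))"

definition arrival :: "(nat \<Rightarrow> nat) \<Rightarrow> nat \<Rightarrow> real \<Rightarrow> nat \<Rightarrow> real" where
  "arrival \<sigma> p x = (\<lambda>i. slope p i * x + intercept \<sigma> p i)"

definition departure :: "(nat \<Rightarrow> nat) \<Rightarrow> real \<Rightarrow> nat \<Rightarrow> real" where
  "departure \<sigma> x i = departures N \<alpha> \<beta> (a(r := x)) (\<sigma> i)"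

definition cost :: "real \<Rightarrow> real" where
  "cost x = total_cost N \<alpha> \<beta> \<gamma> d_opt (a(r := x))"

definition order_end :: "(nat \<Rightarrow> nat) \<Rightarrow> nat \<Rightarrow> real" where
  "order_end \<sigma> p = (if p < N then min ub (a (\<sigma> (Suc p))) else ub)"

text \<open>Only the point \<open>l\<close> is mentioned: when several changes share a breakpoint,
  the recorded order may be wrong immediately to the right.\<close>

definition ordered :: "(nat \<Rightarrow> nat) \<Rightarrow> nat \<Rightarrow> (nat \<Rightarrow> nat) \<Rightarrow> real \<Rightarrow> bool" where
  "ordered \<sigma> p k l \<longleftrightarrow> l \<in> {lb..ub} \<and> bij_betw \<sigma> {1..N} {1..N} \<and> p \<in> {1..N} \<and> \<sigma> p = r \<and>
    mono_on {1..N} (arrival \<sigma> p l) \<and> (\<forall>i\<in>{1..N}. compat k (arrival \<sigma> p l) (departure \<sigma> l) i)"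

lemma arrival_eq:
  assumes "bij_betw \<sigma> {1..N} {1..N}" "p \<in> {1..N}" "\<sigma> p = r" "i \<in> {1..N}"
  shows "arrival \<sigma> p x i = (a(r := x)) (\<sigma> i)"
  using assms inj_onD[OF bij_betw_imp_inj_on[OF assms(1)], of i p]
  unfolding arrival_def slope_def intercept_def by (cases "i = p") auto

lemma departure_balanced:
  assumes s: "bij_betw \<sigma> {1..N} {1..N}" "p \<in> {1..N}" "\<sigma> p = r"
    and mono: "mono_on {1..N} (arrival \<sigma> p x)" and i: "i \<in> {1..N}"
  shows "balanced (arrival \<sigma> p x) (departure \<sigma> x) i"
proof -
  have "mono_on {1..N} (arrival \<sigma> p x) = mono_on {1..N} (\<lambda>i. (a(r := x)) (\<sigma> i))"
    by (rule mono_on_cong) (rule arrival_eq[OF s])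
  with mono have "mono_on {1..N} (\<lambda>i. (a(r := x)) (\<sigma> i))" by simp
  from departures_balanced[OF s(1) this] i
  have "balanced (\<lambda>i. (a(r := x)) (\<sigma> i)) (departure \<sigma> x) i"
    unfolding departure_def by (rule bspec)
  moreover have "balanced (arrival \<sigma> p x) (departure \<sigma> x) i
      = balanced (\<lambda>i. (a(r := x)) (\<sigma> i)) (departure \<sigma> x) i"
    using arrival_eq[OF s] by (intro balanced_cong[OF i] ballI)
  ultimately show ?thesis by (simp only:)
qed

text \<open>Only the arrival at \<open>p\<close> moves. Going right it stays behind no earlier
  arrival, and it passes no later one before \<open>order_end\<close>.\<close>

lemma order_interval:
  assumes "ordered \<sigma> p k l"
  shows "l \<le> order_end \<sigma> p" and "arrival_order N \<alpha> \<beta> (slope p) (intercept \<sigma> p) (departure \<sigma>) l (order_end \<sigma> p)"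
proof -
  have s: "bij_betw \<sigma> {1..N} {1..N}" "p \<in> {1..N}" "\<sigma> p = r" and mono: "mono_on {1..N} (arrival \<sigma> p l)"
    and l: "l \<in> {lb..ub}"
    using assms unfolding ordered_def by auto
  note le = mono_on_intervalD[OF mono]
  have arr_p: "arrival \<sigma> p x p = x" for x unfolding arrival_def slope_def intercept_def by simp
  have arr: "arrival \<sigma> p x i = a (\<sigma> i)" if "i \<noteq> p" for x i
    using that unfolding arrival_def slope_def intercept_def by simp
  show "l \<le> order_end \<sigma> p"
    using le[of p "Suc p"] l s(2) unfolding order_end_def arr_p by (auto simp: arr)
  have arr_mono: "mono_on {1..N} (arrival \<sigma> p x)" if x: "x \<in> {l..order_end \<sigma> p}" for x
  proof (rule mono_onI)
    fix i j assume ij: "i \<in> {1..N}" "j \<in> {1..N}" "i \<le> j"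
    consider "i = j" | "i \<noteq> p" "j \<noteq> p" | "i = p" "p < j" | "i < p" "j = p" using ij by linarith
    then show "arrival \<sigma> p x i \<le> arrival \<sigma> p x j"
    proof cases
      case 2
      then show ?thesis using le[of i j] ij by (simp add: arr)
    next
      case 3
      then have "x \<le> a (\<sigma> (Suc p))" using x ij unfolding order_end_def by auto
      also have "\<dots> \<le> a (\<sigma> j)" using le[of "Suc p" j] 3 ij by (simp add: arr)
      finally show ?thesis using 3 by (simp add: arr arr_p)
    next
      case 4
      then show ?thesis using le[of i p] ij s x by (simp add: arr arr_p)
    qed simp
  qed
  show "arrival_order N \<alpha> \<beta> (slope p) (intercept \<sigma> p) (departure \<sigma>) l (order_end \<sigma> p)"
    using arr_mono departure_balanced[OF s arr_mono]
    by unfold_locales (simp_all add: arrival_def)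
qed

lemma cost_positions:
  assumes s: "bij_betw \<sigma> {1..N} {1..N}" "p \<in> {1..N}" "\<sigma> p = r"
  shows "cost x = (\<Sum>i=1..N. (departure \<sigma> x i - d_opt (\<sigma> i))\<^sup>2
    + \<gamma> * (departure \<sigma> x i - arrival \<sigma> p x i))"
proof -
  have "cost x = (\<Sum>i=1..N. (departure \<sigma> x i - d_opt (\<sigma> i))\<^sup>2
    + \<gamma> * (departure \<sigma> x i - (a(r := x)) (\<sigma> i)))"
    unfolding cost_def total_cost_def departure_def
    by (rule sum.reindex_bij_betw[OF s(1), symmetric])
  then show ?thesis using arrival_eq[OF s] by simp
qed

lemma cost_quadratic:
  assumes s: "bij_betw \<sigma> {1..N} {1..N}" "p \<in> {1..N}" "\<sigma> p = r"
    and dep: "\<forall>i\<in>{1..N}. departure \<sigma> x i = \<theta> i * x + \<eta> i"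
  shows "cost x = ((\<Sum>i=1..N. \<theta> i * \<theta> i) * x
      + (\<Sum>i=1..N. 2 * \<theta> i * (\<eta> i - d_opt (\<sigma> i)) + \<gamma> * (\<theta> i - slope p i))) * x
      + (\<Sum>i=1..N. (\<eta> i - d_opt (\<sigma> i)) * (\<eta> i - d_opt (\<sigma> i)) + \<gamma> * (\<eta> i - intercept \<sigma> p i))"
proof -
  have "cost x = (\<Sum>i=1..N. ((\<theta> i * \<theta> i) * x
      + (2 * \<theta> i * (\<eta> i - d_opt (\<sigma> i)) + \<gamma> * (\<theta> i - slope p i))) * x
      + ((\<eta> i - d_opt (\<sigma> i)) * (\<eta> i - d_opt (\<sigma> i)) + \<gamma> * (\<eta> i - intercept \<sigma> p i)))"
    unfolding cost_positions[OF s]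
    by (rule sum.cong) (auto simp: dep arrival_def power2_eq_square algebra_simps)
  then show ?thesis by (simp only: sum_quadratic)
qed

text \<open>
  A bound on the number of events that departure \<open>i\<close> can still have with arrival \<open>j\<close> before the next arrival
  swap: a convex function goes down through a line at most once and then up through it at most
  once.
\<close>

definition stays_above :: "(nat \<Rightarrow> nat) \<Rightarrow> nat \<Rightarrow> real \<Rightarrow> nat \<Rightarrow> nat \<Rightarrow> bool" where
  "stays_above \<sigma> p l i j \<longleftrightarrow> (\<forall>y\<in>{l<..order_end \<sigma> p}. arrival \<sigma> p y j < departure \<sigma> y i)"

text \<open>\<open>j \<le> k i\<close> says that departure i is recorded as after arrival j. If it
  stays above, only a missing upward event is due; otherwise a downward event may come before an
  upward one. Leaving out the left end ignores the tie there.\<close>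

definition pending :: "(nat \<Rightarrow> nat) \<Rightarrow> nat \<Rightarrow> (nat \<Rightarrow> nat) \<Rightarrow> real \<Rightarrow> nat \<times> nat \<Rightarrow> nat" where
  "pending \<sigma> p k l = (\<lambda>(i, j). if stays_above \<sigma> p l i j then (if j \<le> k i then 0 else 1)
    else (if j \<le> k i then 2 else 1))"

lemma stays_above_mono: "l \<le> l' \<Longrightarrow> stays_above \<sigma> p l i j \<Longrightarrow> stays_above \<sigma> p l' i j"
  unfolding stays_above_def by simp

definition total_pending :: "(nat \<Rightarrow> nat) \<Rightarrow> nat \<Rightarrow> (nat \<Rightarrow> nat) \<Rightarrow> real \<Rightarrow> nat" where
  "total_pending \<sigma> p k l = (\<Sum>ij\<in>{1..N} \<times> {1..N}. pending \<sigma> p k l ij)"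

lemma total_pending_le: "total_pending \<sigma> p k l \<le> 2 * N * N"
proof -
  have "total_pending \<sigma> p k l \<le> (\<Sum>ij\<in>{1..N} \<times> {1..N}. 2)"
    unfolding total_pending_def by (intro sum_mono) (simp add: pending_def split: prod.split)
  then show ?thesis by simp
qed

text \<open>For the other pairs the record is unchanged and \<open>stays_above\<close> can only
  become true, which turns 2 into 0 and leaves 1 as it is.\<close>

lemma total_pending_less:
  assumes "l \<le> l'" and k': "\<forall>i'\<in>{1..N}. \<forall>j'\<in>{1..N}. (i', j') \<noteq> (i, j) \<longrightarrow> (j' \<le> k' i' \<longleftrightarrow> j' \<le> k i')"
    and ij: "i \<in> {1..N}" "j \<in> {1..N}" and less: "pending \<sigma> p k' l' (i, j) < pending \<sigma> p k l (i, j)"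
  shows "total_pending \<sigma> p k' l' < total_pending \<sigma> p k l"
  unfolding total_pending_def
proof (rule sum_strict_mono_ex1)
  show "\<forall>ij\<in>{1..N} \<times> {1..N}. pending \<sigma> p k' l' ij \<le> pending \<sigma> p k l ij"
  proof
    fix ij assume "ij \<in> {1..N} \<times> {1..N}"
    then obtain i' j' where ij': "ij = (i', j')" "i' \<in> {1..N}" "j' \<in> {1..N}" by blast
    show "pending \<sigma> p k' l' ij \<le> pending \<sigma> p k l ij"
    proof (cases "ij = (i, j)")
      case True
      then show ?thesis using less by simp
    next
      case False
      then have "j' \<le> k' i' \<longleftrightarrow> j' \<le> k i'" using k' ij' by blast
      then show ?thesis
        using stays_above_mono[OF \<open>l \<le> l'\<close>, of \<sigma> p i' j'] unfolding pending_def ij'(1) by simp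
    qed
  qed
  show "\<exists>ij\<in>{1..N} \<times> {1..N}. pending \<sigma> p k' l' ij < pending \<sigma> p k l ij"
    using ij less by (intro bexI[of _ "(i, j)"]) simp_all
qed simp

text \<open>No decrease of the potential is asked of a swap, after which convexity starts anew;
  \<open>steps_left\<close> pays for it.\<close>

definition after_event :: "event \<Rightarrow> (nat \<Rightarrow> nat) \<Rightarrow> nat \<Rightarrow> (nat \<Rightarrow> nat) \<Rightarrow> real \<Rightarrow> real \<Rightarrow> bool" where
  "after_event e \<sigma> p k l x = (case e of
      Stop \<Rightarrow> x = ub \<and> ordered \<sigma> p k x
    | Arrival_Swap \<Rightarrow> p < N \<and> ordered (\<sigma>(p := \<sigma> (Suc p), Suc p := \<sigma> p)) (Suc p) k x
    | Departure_Up i \<Rightarrow> ordered \<sigma> p (k(i := k i + 1)) x \<and>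
        total_pending \<sigma> p (k(i := k i + 1)) x < total_pending \<sigma> p k l
    | Departure_Down i \<Rightarrow> ordered \<sigma> p (k(i := k i - 1)) x \<and>
        total_pending \<sigma> p (k(i := k i - 1)) x < total_pending \<sigma> p k l)"

text \<open>The two arrivals coincide, so the arrival times by position are unchanged. Uniqueness
  then fixes the departures by position, and the same \<open>k\<close> remains compatible.\<close>

lemma ordered_swap:
  assumes s: "bij_betw \<sigma> {1..N} {1..N}" "p \<in> {1..N}" "\<sigma> p = r" and p: "p < N"
    and x: "x \<in> {lb..ub}" "x = a (\<sigma> (Suc p))" and mono: "mono_on {1..N} (arrival \<sigma> p x)"
    and k: "\<forall>i\<in>{1..N}. compat k (arrival \<sigma> p x) (departure \<sigma> x) i"
  shows "ordered (\<sigma>(p := \<sigma> (Suc p), Suc p := \<sigma> p)) (Suc p) k x"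
proof -
  define \<tau> where "\<tau> = \<sigma>(p := \<sigma> (Suc p), Suc p := \<sigma> p)"
  have "bij_betw (\<sigma> \<circ> Transposition.transpose p (Suc p)) {1..N} {1..N}"
    using s p by (intro bij_betw_trans[OF _ s(1)] permutes_imp_bij permutes_swap_id) auto
  moreover have "\<sigma> \<circ> Transposition.transpose p (Suc p) = \<tau>"
    unfolding \<tau>_def by (auto simp: fun_eq_iff Transposition.transpose_def)
  ultimately have t: "bij_betw \<tau> {1..N} {1..N}" "Suc p \<in> {1..N}" "\<tau> (Suc p) = r"
    using s p unfolding \<tau>_def by auto
  have arr: "arrival \<tau> (Suc p) x = arrival \<sigma> p x"
    using x unfolding arrival_def slope_def intercept_def \<tau>_def by (auto simp: fun_eq_iff)
  have "departure \<tau> x i = departure \<sigma> x i" if "i \<in> {1..N}" for i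
    using balanced_unique[of N "arrival \<sigma> p x" "departure \<tau> x" "departure \<sigma> x" i]
      departure_balanced[OF s mono] departure_balanced[OF t, of x, unfolded arr, OF mono] that by blast
  then have "compat k (arrival \<sigma> p x) (departure \<tau> x) i" if "i \<in> {1..N}" for i
    using k that unfolding compat_def by simp
  then show ?thesis using t x mono unfolding ordered_def \<tau>_def[symmetric] arr by blast
qed

lemma event_step:
  assumes ord: "ordered \<sigma> p k l"
    and star: "\<forall>i\<in>{1..N}. \<forall>x. star k (\<lambda>i. slope p i * x + intercept \<sigma> p i) (\<lambda>i. \<theta> i * x + \<eta> i) i"
    and x'e: "(x', e) \<in> candidates N ub p k (slope p) (intercept \<sigma> p) \<theta> \<eta>"
    and first: "\<forall>f\<in>candidates N ub p k (slope p) (intercept \<sigma> p) \<theta> \<eta>. not_after (x', e) f"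
  shows "l \<le> x'" and "x' \<le> ub"
    and "\<forall>x\<in>{l..x'}. \<forall>i\<in>{1..N}. departure \<sigma> x i = \<theta> i * x + \<eta> i"
    and "after_event e \<sigma> p k l x'"
proof -
  let ?C = "candidates N ub p k (slope p) (intercept \<sigma> p) \<theta> \<eta>" and ?R = "order_end \<sigma> p"
  have s: "bij_betw \<sigma> {1..N} {1..N}" "p \<in> {1..N}" "\<sigma> p = r" and l: "l \<in> {lb..ub}"
    using ord unfolding ordered_def by auto
  interpret arrival_order N \<alpha> \<beta> "slope p" "intercept \<sigma> p" "departure \<sigma>" l ?R
    by (rule order_interval(2)[OF ord])
  interpret search_interval N \<alpha> \<beta> "slope p" "intercept \<sigma> p" "departure \<sigma>" l ?R \<theta> \<eta> k
    using order_interval(1)[OF ord] star ord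
    by unfold_locales (auto simp: ordered_def arrival_def)
  have arr: "arr = arrival \<sigma> p" unfolding arr_def arrival_def by (auto simp: fun_eq_iff)
  have stop: "(ub, Stop) \<in> ?C"
    and swap: "p < N \<Longrightarrow> (a (\<sigma> (Suc p)), Arrival_Swap) \<in> ?C"
    and ev: "\<And>i. i \<in> {1..N} \<Longrightarrow> set (events i) \<subseteq> ?C"
    unfolding candidates_def intercept_def by auto
  have le: "x' \<le> t" if "(t, f) \<in> ?C" for t f
    using first that unfolding not_after_def by fastforce
  show "x' \<le> ub" using le stop by blast
  have x'_R: "x' \<le> ?R" using le[OF stop] le[OF swap] unfolding order_end_def by auto
  show l_x': "l \<le> x'"
  proof (cases "\<exists>i\<in>{1..N}. (x', e) \<in> set (events i)")
    case True
    then show ?thesis using event_time_ge_l by blast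
  next
    case False
    then have "x' = ub \<or> (p < N \<and> x' = a (\<sigma> (Suc p)))"
      using x'e unfolding candidates_def intercept_def by auto
    then show ?thesis using l l_le_R unfolding order_end_def by auto
  qed
  have evs: "\<forall>i\<in>{1..N}. \<forall>(t, f)\<in>set (events i). x \<le> t" if "x \<le> x'" for x
    using le ev that by fastforce
  show dep: "\<forall>x\<in>{l..x'}. \<forall>i\<in>{1..N}. departure \<sigma> x i = \<theta> i * x + \<eta> i"
    using dep_eq_D[OF _ order_refl evs] x'_R unfolding dep_def by auto
  have x': "x' \<in> {l..?R}" "x' \<in> {lb..ub}" using l_x' x'_R \<open>x' \<le> ub\<close> l by auto
  have D: "dep x' i = departure \<sigma> x' i" if "i \<in> {1..N}" for i
    using dep l_x' that unfolding dep_def by simp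
  have compat_dep: "\<forall>i\<in>{1..N}. compat k (arr x') (dep x') i"
    using dep_compat_balanced[OF x'(1) order_refl evs] by blast
  then have compat_x': "\<forall>i\<in>{1..N}. compat k (arr x') (departure \<sigma> x') i"
    unfolding compat_def using D by auto
  note mono = arr_mono[OF x'(1)]
  have ordI: "ordered \<sigma> p k' x'" if "\<forall>i\<in>{1..N}. compat k' (arr x') (departure \<sigma> x') i" for k'
    using that s x' mono unfolding ordered_def arr by blast
  txt \<open>Departures before the one that has the event keep following their lines up to some
    point \<open>y\<close> beyond the breakpoint.\<close>
  have beyond: "\<exists>y. x' < y \<and> y \<le> ?R \<and> (\<forall>j\<in>{1..<i}. \<forall>(t, f)\<in>set (events j). y \<le> t)"
    if i: "i \<in> {1..N}" and rank: "event_rank e = Suc i" for i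
  proof -
    \<comment> \<open>The times of all candidates that would win a tie against departure i. As
      \<open>e\<close> was chosen, they are strictly later than \<open>x'\<close>, and their minimum
      serves as \<open>y\<close>.\<close>
    define Y where "Y = fst ` {c \<in> ?C. event_rank (snd c) < Suc i}"
    have fin: "finite ?C" unfolding candidates_def by simp
    then have Y: "finite Y" "ub \<in> Y" using stop unfolding Y_def by (simp, force)
    have "x' < t" if "t \<in> Y" for t
      using that first rank unfolding Y_def not_after_def by fastforce
    then have "x' < Min Y" using Y by (metis Min_in empty_iff)
    moreover have "Min Y \<le> ?R"
    proof -
      have "a (\<sigma> (Suc p)) \<in> Y" if "p < N" using swap[OF that] i unfolding Y_def by force
      then show ?thesis using Y unfolding order_end_def by auto
    qed
    moreover have "Min Y \<le> t" if "j \<in> {1..<i}" "(t, f) \<in> set (events j)" for j t f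
    proof -
      have "t \<in> Y" using that ev[of j] i departure_event_list_rank[OF that(2)] unfolding Y_def by force
      then show ?thesis using Y by simp
    qed
    ultimately show ?thesis by blast
  qed
  have event_of: "i \<in> {1..N} \<and> (x', e) \<in> set (events i)" if "event_rank e = Suc i" "e \<noteq> Arrival_Swap" for i
    using x'e that departure_event_list_rank[of x' e] unfolding candidates_def by auto
  show "after_event e \<sigma> p k l x'"
  proof (cases e)
    case Stop
    then have "x' = ub" using x'e departure_event_list_rank[of x' e] unfolding candidates_def by force
    then show ?thesis using Stop ordI[OF compat_x'] unfolding after_event_def by simp
  next
    case Arrival_Swap
    then have "p < N" "x' = a (\<sigma> (Suc p))"
      using x'e departure_event_list_rank[of x' e] unfolding candidates_def intercept_def by force+
    then show ?thesis
      using Arrival_Swap ordered_swap[OF s _ x'(2)] mono compat_x' unfolding after_event_def arr by simp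
  next
    case (Departure_Up i)
    have i: "i \<in> {1..N}" and e: "(x', Departure_Up i) \<in> set (events i)"
      using event_of[of i] Departure_Up by auto
    let ?j = "Suc (k i)" and ?k = "k(i := k i + 1)"
    have meet: "departure \<sigma> x' i = arr x' ?j" and k: "k i < N"
      using event_meets(1)[OF i e] D[OF i] by auto
    have "compat ?k (arr x') (departure \<sigma> x') i"
      \<comment> \<open>Departure and arrival coincide here, so raising \<open>k i\<close> by one
        stays compatible.\<close>
      using meet k compat_x' i mono_on_intervalD[OF mono, of ?j "Suc ?j"] unfolding compat_def by auto
    then have "\<forall>i\<in>{1..N}. compat ?k (arr x') (departure \<sigma> x') i"
      using compat_x' unfolding compat_def by auto
    moreover have "total_pending \<sigma> p ?k x' < total_pending \<sigma> p k l"
    proof (rule total_pending_less[OF l_x', where i = i and j = ?j])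
      obtain y where y: "x' < y" "y \<le> ?R" "\<forall>j\<in>{1..<i}. \<forall>(t, f)\<in>set (events j). y \<le> t"
        using beyond[OF i] Departure_Up by auto
      have above: "arr z ?j < departure \<sigma> z i" if z: "z \<in> {x'<..?R}" for z
      \<comment> \<open>Up to \<open>y\<close> the earlier departures still follow their lines;
        beyond \<open>y\<close> convexity takes over.\<close>
      proof (cases "z \<le> y")
        case True
        then have "\<forall>j\<in>{1..<i}. \<forall>(t, f)\<in>set (events j). z \<le> t" using y(3) by fastforce
        from after_Departure_Up[OF i e _ _ this] show ?thesis using z l_x' by simp
      next
        case False
        have "arr y ?j < departure \<sigma> y i"
          using after_Departure_Up[OF i e _ y(1) y(3)] y(1,2) l_x' by simp
        then show ?thesis
          using overtaken_for_good[OF x'(1) _ i meet, of y z] False z y by auto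
      qed
      have "stays_above \<sigma> p x' i ?j"
        unfolding stays_above_def arr[symmetric] by (intro ballI above)
      \<comment> \<open>The pair drops from 1 to 0.\<close>
      then show "pending \<sigma> p ?k x' (i, ?j) < pending \<sigma> p k l (i, ?j)"
        unfolding pending_def by simp
    qed (use i k in auto)
    ultimately show ?thesis using Departure_Up ordI unfolding after_event_def by simp
  next
    case (Departure_Down i)
    have i: "i \<in> {1..N}" and e: "(x', Departure_Down i) \<in> set (events i)"
      using event_of[of i] Departure_Down by auto
    let ?j = "k i" and ?k = "k(i := k i - 1)"
    have meet: "departure \<sigma> x' i = arr x' ?j" and k: "i < k i"
      using event_meets(2)[OF i e] D[OF i] by auto
    have kN: "k i \<le> N" using k_bounds[OF i] by simp
    have "compat ?k (arr x') (departure \<sigma> x') i"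
      using meet k kN i mono_on_intervalD[OF mono, of "?j - 1" ?j] unfolding compat_def by auto
    then have "\<forall>i\<in>{1..N}. compat ?k (arr x') (departure \<sigma> x') i"
      using compat_x' unfolding compat_def by auto
    moreover have "total_pending \<sigma> p ?k x' < total_pending \<sigma> p k l"
    proof (rule total_pending_less[OF l_x', where i = i and j = ?j])
      obtain y where y: "x' < y" "y \<le> ?R" "\<forall>j\<in>{1..<i}. \<forall>(t, f)\<in>set (events j). y \<le> t"
        using beyond[OF i] Departure_Down by auto
      have "departure \<sigma> y i < arr y ?j"
        using after_Departure_Down[OF i e _ y(1) y(3)] y(1,2) l_x' by simp
      moreover have "y \<in> {l<..?R}" using y l_x' by simp
      \<comment> \<open>The departure is truly below just right of \<open>x'\<close>, so the pair
        counted 2 before and counts 1 now.\<close>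
      ultimately have "\<not> stays_above \<sigma> p l i ?j"
        unfolding stays_above_def arr[symmetric] by (meson order_less_asym)
      moreover have "\<not> ?j \<le> ?k i" using k by simp
      ultimately show "pending \<sigma> p ?k x' (i, ?j) < pending \<sigma> p k l (i, ?j)"
        unfolding pending_def by simp
    qed (use i k kN in auto)
    ultimately show ?thesis using Departure_Down ordI unfolding after_event_def by simp
  qed
qed

end


section \<open>The algorithm\<close>

context coordinate_search
begin

definition best_on :: "real \<Rightarrow> real \<Rightarrow> real \<Rightarrow> bool" where
  "best_on l x c \<longleftrightarrow> x \<in> {lb..l} \<and> c = cost x \<and> (\<forall>y\<in>{lb..l}. c \<le> cost y)"

definition invariant :: "search_state \<Rightarrow> bool" where
  "invariant s \<longleftrightarrow> ordered (user_at s) (pos s) (kvec s) (left_end s) \<and>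
    best_on (left_end s) (best_x s) (best_cost s) \<and> (finished s \<longrightarrow> left_end s = ub)"

text \<open>One step for \<open>Stop\<close>, and for each remaining swap the swap itself plus a
  potential that it may reset to 2 N^2.\<close>

definition steps_left :: "search_state \<Rightarrow> nat" where
  "steps_left s = (if finished s then 0
    else 1 + total_pending (user_at s) (pos s) (kvec s) (left_end s) + (N - pos s) * (2 * N * N + 1))"

lemma best_on_extend:
  assumes best: "best_on l x c" and l: "l \<le> l'" and x': "x' \<in> {l..l'}" "c' = cost x'"
    and min: "\<forall>y\<in>{l..l'}. c' \<le> cost y"
  shows "best_on l' (if c' < c then x' else x) (if c' < c then c' else c)"
proof -
  have "(if c' < c then c' else c) \<le> cost y" if "y \<in> {lb..l'}" for y
  proof (cases "y \<le> l")
    case True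
    then have "y \<in> {lb..l}" using that by simp
    then have "c \<le> cost y" using best unfolding best_on_def by blast
    then show ?thesis by simp
  next
    case False
    then have "c' \<le> cost y" using min that by simp
    then show ?thesis by simp
  qed
  then show ?thesis using best l x' unfolding best_on_def by auto
qed

lemma apply_event_invariant:
  assumes after: "after_event e (user_at s) (pos s) (kvec s) (left_end s) x"
    and same: "user_at t = user_at s" "pos t = pos s" "kvec t = kvec s" "left_end t = x"
    and fin: "\<not> finished s" "\<not> finished t" and best: "best_on x (best_x t) (best_cost t)"
  shows "invariant (apply_event e t) \<and> steps_left (apply_event e t) < steps_left s"
proof (cases e)
  case Stop
  then have "x = ub" "ordered (user_at s) (pos s) (kvec s) x"
    using after unfolding after_event_def by auto
  then show ?thesis
    using Stop same fin best unfolding invariant_def steps_left_def by simp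
next
  case Arrival_Swap
  let ?\<tau> = "(user_at s)(pos s := user_at s (Suc (pos s)), Suc (pos s) := user_at s (pos s))"
  have p: "pos s < N" using after Arrival_Swap unfolding after_event_def by simp
  have "total_pending ?\<tau> (Suc (pos s)) (kvec s) x + (N - Suc (pos s)) * (2 * N * N + 1)
      < (2 * N * N + 1) + (N - Suc (pos s)) * (2 * N * N + 1)"
    using total_pending_le[of ?\<tau> "Suc (pos s)" "kvec s" x] by simp
  also have "\<dots> = (N - pos s) * (2 * N * N + 1)"
    using p by (metis Suc_diff_Suc mult_Suc)
  finally show ?thesis
    using assms Arrival_Swap unfolding after_event_def invariant_def steps_left_def by simp
next
  case (Departure_Up i)
  then show ?thesis
    using assms unfolding after_event_def invariant_def steps_left_def by simp
next
  case (Departure_Down i)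
  then show ?thesis
    using assms unfolding after_event_def invariant_def steps_left_def by simp
qed

section \<open>Cost of a step, of the initialisation and of the whole search\<close>

lemma spec_search_step:
  assumes inv: "invariant s" and fin: "\<not> finished s"
  shows "spec (search_step N \<alpha> \<beta> \<gamma> d_opt a ub s) (61 * N * N)
    (\<lambda>t. invariant t \<and> steps_left t < steps_left s)"
proof -
  let ?\<sigma> = "user_at s" and ?p = "pos s" and ?k = "kvec s" and ?l = "left_end s"
  let ?\<phi> = "slope ?p" and ?\<zeta> = "intercept ?\<sigma> ?p"
  let ?P = "\<lambda>t. invariant t \<and> steps_left t < steps_left s"
  have ord: "ordered ?\<sigma> ?p ?k ?l" and best: "best_on ?l (best_x s) (best_cost s)"
    using inv unfolding invariant_def by auto
  have \<sigma>: "bij_betw ?\<sigma> {1..N} {1..N}" "?p \<in> {1..N}" "?\<sigma> ?p = r"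
    and k: "\<forall>i\<in>{1..N}. i \<le> ?k i \<and> ?k i \<le> N"
    using ord unfolding ordered_def compat_def by auto
  have "spec (search_step N \<alpha> \<beta> \<gamma> d_opt a ub s)
      (N * (4 * N + 19) + ((10 * N + 1) + (16 * N + (10 + ((0 + (0 + 1)) + 0))))) ?P"
    unfolding search_step_def Let_def slope_def[symmetric] intercept_def[symmetric]
  proof (rule spec_bind[OF spec_coefficients[OF k order_refl]], clarify)
    fix \<theta> \<eta> :: "nat \<Rightarrow> real"
    assume star: "\<forall>i\<in>{1..N}. \<forall>x. star ?k (\<lambda>i. ?\<phi> i * x + ?\<zeta> i) (\<lambda>i. \<theta> i * x + \<eta> i) i"
    define A where "A = (\<Sum>i=1..N. \<theta> i * \<theta> i)"
    define B where "B = (\<Sum>i=1..N. 2 * \<theta> i * (\<eta> i - d_opt (?\<sigma> i)) + \<gamma> * (\<theta> i - ?\<phi> i))"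
    define C where "C = (\<Sum>i=1..N. (\<eta> i - d_opt (?\<sigma> i)) * (\<eta> i - d_opt (?\<sigma> i)) + \<gamma> * (\<eta> i - ?\<zeta> i))"
    note coeffs = computes_cost_coefficients[of N \<gamma> d_opt ?\<sigma> ?\<phi> ?\<zeta> \<theta> \<eta>, folded A_def B_def C_def]
    let ?finish = "\<lambda>x' e x c. State_Monad.bind (val c <\<^sub>c val (best_cost s)) (\<lambda>better.
          val (apply_event e ((if better then s\<lparr>best_x := x, best_cost := c\<rparr> else s)\<lparr>left_end := x'\<rparr>)))"
    let ?minimize = "\<lambda>x' e (A, B, C). State_Monad.bind (minimize_quadratic A B C ?l x') (\<lambda>(x, c). ?finish x' e x c)"
    show "spec (State_Monad.bind (next_breakpoint N ub ?p ?k ?\<phi> ?\<zeta> \<theta> \<eta>) (\<lambda>(x', e).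
        State_Monad.bind (cost_coefficients N \<gamma> d_opt ?\<sigma> ?\<phi> ?\<zeta> \<theta> \<eta>) (?minimize x' e)))
      ((10 * N + 1) + (16 * N + (10 + ((0 + (0 + 1)) + 0)))) ?P"
    proof (rule spec_bind[OF spec_next_breakpoint], clarify)
      fix x' e
      assume ev: "(x', e) \<in> candidates N ub ?p ?k ?\<phi> ?\<zeta> \<theta> \<eta>"
        "\<forall>f\<in>candidates N ub ?p ?k ?\<phi> ?\<zeta> \<theta> \<eta>. not_after (x', e) f"
      note step = event_step[OF ord star ev]
      have cost: "cost x = (A * x + B) * x + C" if "x \<in> {?l..x'}" for x
        unfolding A_def B_def C_def using step(3) that by (intro cost_quadratic[OF \<sigma>]) blast
      have "0 \<le> A" unfolding A_def by (intro sum_nonneg) simp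
      note min = spec_minimize_quadratic[OF this step(1), of B C]
      have "spec (?minimize x' e (A, B, C)) (10 + ((0 + (0 + 1)) + 0)) ?P"
        unfolding prod.case
      proof (rule spec_bind[OF min], clarify)
        fix x
        assume x: "x \<in> {?l..x'}" "\<forall>y\<in>{?l..x'}. (A * x + B) * x + C \<le> (A * y + B) * y + C"
        let ?c = "(A * x + B) * x + C"
        have *: "best_on x' (if ?c < best_cost s then x else best_x s)
            (if ?c < best_cost s then ?c else best_cost s)"
          using x step(1) cost by (intro best_on_extend[OF best]) simp_all
        have "?P (apply_event e ((if ?c < best_cost s then s\<lparr>best_x := x, best_cost := ?c\<rparr> else s)\<lparr>left_end := x'\<rparr>))"
          using * fin by (intro apply_event_invariant[OF step(4)]) (simp_all split: if_splits)
        then show "spec (?finish x' e x ?c) ((0 + (0 + 1)) + 0) ?P"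
          by (intro computes_bind[OF computes_counted2[OF computes_val computes_val]] spec_val)
      qed
      then show "spec (State_Monad.bind (cost_coefficients N \<gamma> d_opt ?\<sigma> ?\<phi> ?\<zeta> \<theta> \<eta>) (?minimize x' e))
        (16 * N + (10 + ((0 + (0 + 1)) + 0))) ?P"
        by (rule computes_bind[OF coeffs])
    qed
  qed
  \<comment> \<open>The sum is 4 N^2 + 45 N + 12, and 61 = 4 + 45 + 12.\<close>
  moreover have "N * (4 * N + 19) + ((10 * N + 1) + (16 * N + (10 + ((0 + (0 + 1)) + 0))))
      \<le> 61 * N * N"
  proof -
    have "1 \<le> N * N" "N \<le> N * N" using N_pos by simp_all
    then have "4 * (N * N) + 45 * N + 12 \<le> 61 * (N * N)" by linarith
    then show ?thesis by (simp add: algebra_simps)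
  qed
  ultimately show ?thesis by (rule spec_weaken)
qed

lemma spec_initial_state:
  "spec (initial_state N \<alpha> \<beta> \<gamma> d_opt r a lb) (24 * N * N) (\<lambda>s. invariant s \<and> \<not> finished s)"
proof -
  let ?a = "a(r := lb)"
  let ?P = "\<lambda>s. invariant s \<and> \<not> finished s"
  let ?cost = "\<lambda>\<sigma> b d. sum_c (map (\<lambda>i.
                (val (d i) -\<^sub>c val (d_opt (\<sigma> i))) *\<^sub>c (val (d i) -\<^sub>c val (d_opt (\<sigma> i)))
                +\<^sub>c val \<gamma> *\<^sub>c (val (d i) -\<^sub>c val (b i))) [1..<Suc N])"
  let ?finish = "\<lambda>\<sigma> b (d, k). State_Monad.bind (?cost \<sigma> b d) (\<lambda>c.
         val \<lparr> left_end = lb, user_at = \<sigma>, pos = hd (filter (\<lambda>i. \<sigma> i = r) [1..<Suc N]),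
               kvec = k, best_x = lb, best_cost = c, finished = False \<rparr>)"
  have "spec (initial_state N \<alpha> \<beta> \<gamma> d_opt r a lb)
      (length [1..<Suc N] * length [1..<Suc N] + (N * (6 * N + 10) + ((Suc N - 1) * (6 + 1) + 0))) ?P"
    unfolding initial_state_def Let_def
  proof (rule spec_bind[OF spec_sort_users], elim conjE)
    fix us :: "nat list"
    assume mset: "mset us = mset [1..<Suc N]" and sorted: "sorted_wrt (\<lambda>u v. ?a u \<le> ?a v) us"
    define \<sigma> where "\<sigma> = (\<lambda>i. us ! (i - 1))"
    define b where "b = (\<lambda>i. ?a (\<sigma> i))"
    have us: "length us = N" "set us = {1..N}" "distinct us"
      using mset_eq_length[OF mset] mset_eq_setD[OF mset] mset_eq_imp_distinct_iff[OF mset] by auto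
    \<comment> \<open>Positions start at 1, list indices at 0.\<close>
    have "bij_betw (\<lambda>i. i - 1) {1..N} {..<N}"
      by (rule bij_betw_byWitness[where f' = Suc]) auto
    moreover have "bij_betw ((!) us) {..<N} {1..N}"
      using us by (intro bij_betw_nth) auto
    ultimately have bij: "bij_betw \<sigma> {1..N} {1..N}"
      using bij_betw_trans unfolding \<sigma>_def comp_def by fastforce
    have mono: "mono_on {1..N} b"
    proof (rule mono_onI)
      fix i j assume "i \<in> {1..N}" "j \<in> {1..N}" "i \<le> j"
      then show "b i \<le> b j"
        unfolding b_def \<sigma>_def
        using sorted_wrt_nth_less[OF sorted, of "i - 1" "j - 1"] us by (cases "i = j") auto
    qed
    define p where "p = hd (filter (\<lambda>i. \<sigma> i = r) [1..<Suc N])"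
    obtain i where "i \<in> {1..N}" "\<sigma> i = r" using bij_betw_imp_surj_on[OF bij] r by (metis imageE)
    then have p: "p \<in> {1..N}" "\<sigma> p = r"
      using hd_filter_upt(1-3)[of "\<lambda>i. \<sigma> i = r" i 1 "Suc N"] unfolding p_def by auto
    have b: "\<forall>i\<in>{1..N}. b i = arrival \<sigma> p lb i" unfolding b_def using arrival_eq[OF bij p] by simp
    have mono': "mono_on {1..N} (arrival \<sigma> p lb)"
      using mono mono_on_cong[of "{1..N}" b "arrival \<sigma> p lb"] b by simp
    have "spec (State_Monad.bind (initial_departures N \<alpha> \<beta> b N) (?finish \<sigma> b))
      (N * (6 * N + 10) + ((Suc N - 1) * (6 + 1) + 0)) ?P"
      unfolding p_def[symmetric]
    proof (rule spec_bind[OF spec_initial_departures[OF mono order_refl]], clarify)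
      fix d :: "nat \<Rightarrow> real" and k :: "nat \<Rightarrow> nat"
      assume dk: "\<forall>i\<in>{1..N}. balanced b d i \<and> compat k b d i"
      have bal: "\<forall>i\<in>{1..N}. balanced (arrival \<sigma> p lb) d i" using dk balanced_cong[OF _ b] by blast
      have d: "d i = departure \<sigma> lb i" if "i \<in> {1..N}" for i
        using balanced_unique[OF bal _ that, of "departure \<sigma> lb"] departure_balanced[OF bij p mono']
        by blast
      have "compat k (arrival \<sigma> p lb) (departure \<sigma> lb) i" if "i \<in> {1..N}" for i
        using compat_cong[of i b "arrival \<sigma> p lb" d "departure \<sigma> lb" k] b d[OF that] dk that by simp
      then have ord: "ordered \<sigma> p k lb"
        using bij p mono' lb_le_ub unfolding ordered_def by simp
      let ?term = "\<lambda>i. (d i - d_opt (\<sigma> i)) * (d i - d_opt (\<sigma> i)) + \<gamma> * (d i - b i)"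
      have c: "computes (?cost \<sigma> b d) ((Suc N - 1) * (6 + 1)) (\<Sum>i=1..<Suc N. ?term i)"
        by (rule computes_sum_upt) (simp add: spec_def counted2_def State_Monad.update_def)
      have "(\<Sum>i=1..<Suc N. ?term i) = cost lb"
        unfolding cost_positions[OF bij p] atLeastLessThanSuc_atLeastAtMost
        using d b by (intro sum.cong) (auto simp: power2_eq_square)
      then have inv: "?P \<lparr> left_end = lb, user_at = \<sigma>, pos = p, kvec = k, best_x = lb,
          best_cost = (\<Sum>i=1..<Suc N. ?term i), finished = False \<rparr>"
        using ord unfolding invariant_def best_on_def by simp
      show "spec (State_Monad.bind (?cost \<sigma> b d) (\<lambda>c. val \<lparr> left_end = lb, user_at = \<sigma>, pos = p,
               kvec = k, best_x = lb, best_cost = c, finished = False \<rparr>))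
        ((Suc N - 1) * (6 + 1) + 0) ?P"
        by (rule computes_bind[OF c], rule spec_val, rule inv)
    qed
    then show "spec (State_Monad.bind (initial_departures N \<alpha> \<beta> (\<lambda>i. ?a (us ! (i - 1))) N)
        (?finish (\<lambda>i. us ! (i - 1)) (\<lambda>i. ?a (us ! (i - 1)))))
      (N * (6 * N + 10) + ((Suc N - 1) * (6 + 1) + 0)) ?P"
      unfolding b_def \<sigma>_def .
  qed
  moreover have "length [1..<Suc N] * length [1..<Suc N] + (N * (6 * N + 10) + ((Suc N - 1) * (6 + 1) + 0))
      \<le> 24 * N * N"
  proof -
    have "N \<le> N * N" using N_pos by simp
    then have "7 * (N * N) + 17 * N \<le> 24 * (N * N)" by linarith
    then show ?thesis by (simp add: algebra_simps)
  qed
  ultimately show ?thesis by (rule spec_weaken)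
qed

text \<open>The loop invariant is amortised: the counter plus the price of all steps still allowed
  never exceeds its initial value.\<close>

lemma search_loop:
  assumes inv: "invariant s0"
  shows "\<exists>s n. while_c (\<lambda>s. \<not> finished s) (search_step N \<alpha> \<beta> \<gamma> d_opt a ub) (s0, n0) = Some (s, n) \<and>
    best_on ub (best_x s) (best_cost s) \<and> n \<le> n0 + 61 * N * N * steps_left s0"
proof -
  let ?b = "\<lambda>(s, n :: nat). \<not> finished s"
  let ?c = "\<lambda>(s, n). run_state (search_step N \<alpha> \<beta> \<gamma> d_opt a ub s) n"
  let ?P = "\<lambda>(s, n). invariant s \<and> n + 61 * N * N * steps_left s \<le> n0 + 61 * N * N * steps_left s0"
  let ?f = "\<lambda>(s, n :: nat). steps_left s"
  have step: "?P (?c z) \<and> ?f (?c z) < ?f z" if P: "?P z" and b: "?b z" for z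
  proof -
    obtain s n where z: "z = (s, n)" by (cases z)
    obtain t m where run: "run_state (search_step N \<alpha> \<beta> \<gamma> d_opt a ub s) n = (t, m)"
      by (cases "run_state (search_step N \<alpha> \<beta> \<gamma> d_opt a ub s) n")
    have "invariant s" "\<not> finished s" using P b z by auto
    from spec_search_step[OF this, unfolded spec_def, rule_format, of n]
    have t: "invariant t" "steps_left t < steps_left s" and m: "m \<le> n + 61 * N * N"
      unfolding run by simp_all
    have "m + 61 * N * N * steps_left t \<le> n + 61 * N * N * Suc (steps_left t)" using m by simp
    also have "\<dots> \<le> n + 61 * N * N * steps_left s"
      using t(2) by (intro add_left_mono mult_left_mono) simp_all
    finally show ?thesis using P t unfolding z by (simp add: run)
  qed
  have init: "?P (s0, n0)" using inv by simp
  obtain z where z: "while_option ?b ?c (s0, n0) = Some z"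
    using measure_while_option_Some[of ?P ?b ?c ?f, OF step init] by blast
  obtain s n where sn: "z = (s, n)" by (cases z)
  have "?P z" by (rule while_option_rule[where P = ?P, OF conjunct1[OF step] z init])
  moreover have "\<not> ?b z" using while_option_stop[OF z] .
  ultimately show ?thesis
    using z unfolding while_c_def sn invariant_def by auto
qed

text \<open>At most N orders of arrivals occur, each with at most 2 N^2 + 1 steps.\<close>

lemma steps_left_le:
  assumes "invariant s"
  shows "steps_left s \<le> 3 * N ^ 3"
proof -
  have p: "pos s \<in> {1..N}" using assms unfolding invariant_def ordered_def by simp
  have "steps_left s \<le> (2 * N * N + 1) + (N - pos s) * (2 * N * N + 1)"
    unfolding steps_left_def
    using total_pending_le[of "user_at s" "pos s" "kvec s" "left_end s"] by simp
  also have "\<dots> = Suc (N - pos s) * (2 * N * N + 1)" by simp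
  also have "\<dots> \<le> N * (2 * N * N + 1)" using p by (intro mult_right_mono) auto
  also have "\<dots> = 2 * N ^ 3 + N" by (simp add: power3_eq_cube)
  also have "\<dots> \<le> 3 * N ^ 3" using N_pos self_le_power[of N 3] by simp
  finally show ?thesis .
qed

lemma global_search_correct:
  assumes lb: "lb = lower_arrival N \<alpha> \<beta> d_opt" and ub: "ub = upper_arrival N \<alpha> \<beta> d_opt"
  shows "\<exists>x c n. global_search N \<alpha> \<beta> \<gamma> d_opt r a = Some (x, c, n) \<and> best_on ub x c \<and> n \<le> 213 * N ^ 5"
proof -
  define w where "w = real N / (\<beta> - \<alpha> * (real N - 1))"
  let ?init = "State_Monad.bind (val (real N) /\<^sub>c (val \<beta> -\<^sub>c val \<alpha> *\<^sub>c (val (real N) -\<^sub>c val 1)))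
    (\<lambda>w. State_Monad.bind (val (d_opt 1) -\<^sub>c val w) (\<lambda>lb.
      State_Monad.bind (val (d_opt N) +\<^sub>c val w) (\<lambda>ub.
      State_Monad.bind (initial_state N \<alpha> \<beta> \<gamma> d_opt r a lb) (\<lambda>s. val (s, ub)))))"
  have lu: "d_opt 1 - w = lb" "d_opt N + w = ub"
    unfolding lb ub lower_arrival_def upper_arrival_def w_def by simp_all
  have w: "computes (val (real N) /\<^sub>c (val \<beta> -\<^sub>c val \<alpha> *\<^sub>c (val (real N) -\<^sub>c val 1))) 4 w"
    and l: "computes (val (d_opt 1) -\<^sub>c val w) 1 lb"
    and u: "computes (val (d_opt N) +\<^sub>c val w) 1 ub"
    unfolding lu[symmetric] by (simp_all add: spec_def counted2_def State_Monad.update_def w_def)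
  have spec: "spec ?init (4 + (1 + (1 + (24 * N * N + 0)))) (\<lambda>(s, u). invariant s \<and> u = ub)"
    by (rule computes_bind[OF w], rule computes_bind[OF l], rule computes_bind[OF u],
        rule spec_bind[OF spec_initial_state], rule spec_val) simp
  obtain v n0 where "run_state ?init 0 = (v, n0)" by (rule prod.exhaust)
  moreover obtain s0 u where "v = (s0, u)" by (rule prod.exhaust)
  ultimately have run: "run_state ?init 0 = ((s0, u), n0)" by simp
  have inv: "invariant s0" "u = ub" and n0: "n0 \<le> 24 * N * N + 6"
    using spec[unfolded spec_def, rule_format, of 0] unfolding run by auto
  obtain s n where loop: "while_c (\<lambda>s. \<not> finished s) (search_step N \<alpha> \<beta> \<gamma> d_opt a ub) (s0, n0) = Some (s, n)"
    and best: "best_on ub (best_x s) (best_cost s)" and n: "n \<le> n0 + 61 * N * N * steps_left s0"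
    using search_loop[OF inv(1)] by blast
  have "global_search N \<alpha> \<beta> \<gamma> d_opt r a = Some (best_x s, best_cost s, n)"
    unfolding global_search_def run Let_def inv(2) by (simp add: loop)
  \<comment> \<open>The steps contribute 61 * 3 = 183, and the initialisation 24 + 6 = 30.\<close>
  moreover have "n \<le> 213 * N ^ 5"
  proof -
    have "61 * N * N * steps_left s0 \<le> 61 * N * N * (3 * N ^ 3)"
      using steps_left_le[OF inv(1)] by (rule mult_left_mono) simp
    also have "\<dots> = 183 * N ^ 5"
      using power_add[of N 2 3] by (simp add: power2_eq_square)
    finally have 1: "61 * N * N * steps_left s0 \<le> 183 * N ^ 5" .
    have "N ^ 2 \<le> N ^ 5" "1 \<le> N ^ 5" using N_pos by (auto intro: power_increasing)
    then have "24 * N * N + 6 \<le> 30 * N ^ 5" by (simp add: power2_eq_square)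
    with 1 n n0 show ?thesis by linarith
  qed
  ultimately show ?thesis using best by blast
qed

end

text \<open>One bound function serves all data, as the constant 213 involves neither rates nor
  costs. The increasing order of \<open>d_opt\<close> makes the search interval nonempty.\<close>

theorem corollary5p4:
  shows "\<exists>T :: nat \<Rightarrow> real. T \<in> O(\<lambda>N. real N ^ 5) \<and>
    (\<forall>(N::nat) (\<alpha>::real) (\<beta>::real) (\<gamma>::real) (d_opt :: nat \<Rightarrow> real) (r::nat) (a :: nat \<Rightarrow> real).
      N \<ge> 1 \<and> \<alpha> > 0 \<and> \<beta> > 0 \<and> real N < \<beta> / \<alpha> + 1 \<and> \<gamma> \<ge> 0 \<and>
      mono_on {1..N} d_opt \<and> r \<in> {1..N} \<and>
      (\<forall>j\<in>{1..N} - {r}. a j \<in> {lower_arrival N \<alpha> \<beta> d_opt..upper_arrival N \<alpha> \<beta> d_opt})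
      \<longrightarrow>
      (\<exists>x c n. global_search N \<alpha> \<beta> \<gamma> d_opt r a = Some (x, c, n) \<and>
        x \<in> {lower_arrival N \<alpha> \<beta> d_opt..upper_arrival N \<alpha> \<beta> d_opt} \<and>
        c = total_cost N \<alpha> \<beta> \<gamma> d_opt (a(r := x)) \<and>
        (\<forall>y\<in>{lower_arrival N \<alpha> \<beta> d_opt..upper_arrival N \<alpha> \<beta> d_opt}.
          total_cost N \<alpha> \<beta> \<gamma> d_opt (a(r := x)) \<le> total_cost N \<alpha> \<beta> \<gamma> d_opt (a(r := y))) \<and>
        real n \<le> T N))"
proof (intro exI[of _ "\<lambda>N. 213 * real N ^ 5"] conjI allI impI, goal_cases)
  case 1
  show ?case by simp
next
  case (2 N \<alpha> \<beta> \<gamma> d_opt r a)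
  let ?lb = "lower_arrival N \<alpha> \<beta> d_opt" and ?ub = "upper_arrival N \<alpha> \<beta> d_opt"
  have rate: "\<alpha> * (real N - 1) < \<beta>" 
  proof -
    have "0 < \<alpha>" "real N - 1 < \<beta> / \<alpha>" using 2 by auto
    then show ?thesis by (simp add: pos_less_divide_eq mult.commute)
  qed
  have "d_opt 1 \<le> d_opt N" using 2 mono_on_intervalD[of N d_opt 1 N] by simp
  moreover have "0 \<le> real N / (\<beta> - \<alpha> * (real N - 1))" using rate by simp
  ultimately have "?lb \<le> ?ub" unfolding lower_arrival_def upper_arrival_def by linarith
  then interpret coordinate_search N \<alpha> \<beta> \<gamma> d_opt r a ?lb ?ub
    using 2 rate by unfold_locales auto
  obtain x c n where search: "global_search N \<alpha> \<beta> \<gamma> d_opt r a = Some (x, c, n)"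
    and best: "best_on ?ub x c" and n: "n \<le> 213 * N ^ 5"
    using global_search_correct[OF refl refl] by blast
  have "real n \<le> real (213 * N ^ 5)" using n by (rule of_nat_mono)
  then show ?case using search best unfolding best_on_def cost_def by auto
qed

end
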